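(* Let $(\mathcal{W},\mathcal{V})$ be an AVWC with finite alphabets $\mathcal{X},\mathcal{Y},\mathcal{Z}$, finite state set $\mathcal{S}$, cost function $c:\mathcal{S}\to[0,\infty)$ and cost constraint $\Lambda>0$ on the states. Then every real number $R\ge0$ satisfying \[ R \leq \max_{U} \Big[\min_{q\in\mathcal{P}(\mathcal{S},\Lambda)}I(U;Y_q) - \max_{q'\in\mathcal{P}(\mathcal{S},\Lambda)}\bar{I}_{q'}(U; Z_{\mathcal{S}})\Big] \] is achievable by random code (with respect to the maximal decoding error probability and the strong secrecy criterion) over that AVWC with cost constraint $\Lambda$ on the states. Here the maximum is over $U$ on a finite alphabet with joint pmf $P_{UX}$, $\Pr\{U=u,Y_q=y\}=\sum_xP_{UX}(u,x)W_q(y|x)$, $\Pr\{U=u,Z_s=z\}=\sum_xP_{UX}(u,x)V_s(z|x)$.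
   Context: AVWC $(\mathcal{W},\mathcal{V})$: $\mathcal{W}=\{W_s\}_{s\in\mathcal{S}}$ transition matrices $\mathcal{X}\to\mathcal{Y}$, $\mathcal{V}=\{V_s\}_{s\in\mathcal{S}}$ transition matrices $\mathcal{X}\to\mathcal{Z}$; $W(y^N|x^N,s^N)=\prod_iW_{s_i}(y_i|x_i)$, $V(z^N|x^N,s^N)=\prod_iV_{s_i}(z_i|x_i)$; states unknown to transmitter and receiver. $\mathcal{P}(\mathcal{S})$ = pmfs on $\mathcal{S}$; $W_q=\sum_sq(s)W_s$. For $q\in\mathcal{P}(\mathcal{S})$, $\bar I_q(U;Z_{\mathcal{S}})=\sum_{s\in\mathcal{S}}q(s)I(U;Z_s)$. Costs: $c(s^N)=\frac1N\sum_{i=1}^Nc(s_i)$, $c(q)=\sum_sc(s)q(s)$, $\mathcal{P}(\mathcal{S},\Lambda)=\{q\in\mathcal{P}(\mathcal{S}):c(q)\le\Lambda\}$. A random code of length $N$ is a random pair $(F,\Phi)$ over a finite family $\{(f_g,\phi_g)\}$ of deterministic codes $f_g:\mathcal{M}\to\mathcal{X}^N$, $\phi_g:\mathcal{Y}^N\to\mathcal{M}$. For $s^N$, $\lambda(\mathcal{W},F,\Phi,s^N)=\max_mE[1-W(\Phi^{-1}(m)|F(m),s^N)]$ with $W(D|x^N,s^N)=\sum_{y^N\in D}W(y^N|x^N,s^N)$, and $\lambda(\mathcal{W},F,\Phi,\Lambda)=\max_{s^N:c(s^N)\le\Lambda}\lambda(\mathcal{W},F,\Phi,s^N)$. $M$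 is uniform on $\mathcal{M}$ and independent of $(F,\Phi)$, $X^N=F(M)$, and $Z^N(s^N)$ satisfies $\Pr\{Z^N(s^N)=z^N|X^N=x^N,M,F,\Phi\}=V(z^N|x^N,s^N)$. $R\ge0$ is achievable by random code over the AVWC with cost constraint $\Lambda$ if for every $\epsilon>0$ and all sufficiently large $N$ there is a random code with $\frac1N\log|\mathcal{M}|>R-\epsilon$, $\lambda(\mathcal{W},F,\Phi,\Lambda)<\epsilon$ and $\max_{s^N:c(s^N)\le\Lambda}I(M;Z^N(s^N)|\Phi)<\epsilon$. *)

theory Defs
  imports Complex_Main "HOL-Library.FuncSet"
begin

(* All information quantities are measured in bits (log base 2), consistently with the rate
   (1/N) log |M|. *)

definition mutual_info :: "'a set \<Rightarrow> 'b set \<Rightarrow> ('a \<Rightarrow> 'b \<Rightarrow> real) \<Rightarrow> real" where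
  "mutual_info A B P =
     (\<Sum>a\<in>A. \<Sum>b\<in>B. if P a b = 0 then 0
        else P a b * log 2 (P a b / ((\<Sum>b'\<in>B. P a b') * (\<Sum>a'\<in>A. P a' b))))"

definition cond_mutual_info ::
  "'a set \<Rightarrow> 'b set \<Rightarrow> 'c set \<Rightarrow> ('a \<Rightarrow> 'b \<Rightarrow> 'c \<Rightarrow> real) \<Rightarrow> real" where
  "cond_mutual_info A B C P =
     (\<Sum>a\<in>A. \<Sum>b\<in>B. \<Sum>c\<in>C. if P a b c = 0 then 0
        else P a b c * log 2 (P a b c * (\<Sum>a'\<in>A. \<Sum>b'\<in>B. P a' b' c)
               / ((\<Sum>b'\<in>B. P a b' c) * (\<Sum>a'\<in>A. P a' b c))))"

text \<open>A family of transition matrices indexed by states: W s x y = W_s(y|x).\<close>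
definition channel_family :: "('s::finite \<Rightarrow> 'x::finite \<Rightarrow> 'y::finite \<Rightarrow> real) \<Rightarrow> bool" where
  "channel_family W \<longleftrightarrow> (\<forall>s x y. 0 \<le> W s x y) \<and> (\<forall>s x. (\<Sum>y\<in>UNIV. W s x y) = 1)"

definition is_pmf :: "('s::finite \<Rightarrow> real) \<Rightarrow> bool" where
  "is_pmf q \<longleftrightarrow> (\<forall>s. 0 \<le> q s) \<and> (\<Sum>s\<in>UNIV. q s) = 1"

definition cost_pmf :: "('s::finite \<Rightarrow> real) \<Rightarrow> ('s \<Rightarrow> real) \<Rightarrow> real" where
  "cost_pmf c q = (\<Sum>s\<in>UNIV. c s * q s)"

definition pmfs_cost :: "('s::finite \<Rightarrow> real) \<Rightarrow> real \<Rightarrow> ('s \<Rightarrow> real) set" where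
  "pmfs_cost c \<Lambda> = {q. is_pmf q \<and> cost_pmf c q \<le> \<Lambda>}"

definition avg_channel :: "('s::finite \<Rightarrow> 'x \<Rightarrow> 'y \<Rightarrow> real) \<Rightarrow> ('s \<Rightarrow> real) \<Rightarrow> 'x \<Rightarrow> 'y \<Rightarrow> real" where
  "avg_channel W q x y = (\<Sum>s\<in>UNIV. q s * W s x y)"

text \<open>Auxiliary variable U on the finite alphabet {..<k} with joint pmf PUX on {..<k} x X.\<close>
definition is_aux_pmf :: "nat \<Rightarrow> (nat \<Rightarrow> 'x::finite \<Rightarrow> real) \<Rightarrow> bool" where
  "is_aux_pmf k PUX \<longleftrightarrow> (\<forall>u x. 0 \<le> PUX u x) \<and> (\<Sum>u<k. \<Sum>x\<in>UNIV. PUX u x) = 1"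

definition mi_aux :: "nat \<Rightarrow> (nat \<Rightarrow> 'x::finite \<Rightarrow> real) \<Rightarrow> ('x \<Rightarrow> 'y::finite \<Rightarrow> real) \<Rightarrow> real" where
  "mi_aux k PUX T = mutual_info {..<k} UNIV (\<lambda>u y. \<Sum>x\<in>UNIV. PUX u x * T x y)"

definition avg_mi_aux ::
  "nat \<Rightarrow> (nat \<Rightarrow> 'x::finite \<Rightarrow> real) \<Rightarrow> ('s::finite \<Rightarrow> 'x \<Rightarrow> 'z::finite \<Rightarrow> real) \<Rightarrow> ('s \<Rightarrow> real) \<Rightarrow> real" where
  "avg_mi_aux k PUX V q = (\<Sum>s\<in>UNIV. q s * mi_aux k PUX (V s))"

definition block_prob :: "('s \<Rightarrow> 'x \<Rightarrow> 'y \<Rightarrow> real) \<Rightarrow> 'y list \<Rightarrow> 'x list \<Rightarrow> 's list \<Rightarrow> real" where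
  "block_prob W ys xs ss = (\<Prod>i<length ss. W (ss ! i) (xs ! i) (ys ! i))"

definition seqs :: "nat \<Rightarrow> 'a set \<Rightarrow> 'a list set" where
  "seqs N A = {xs. length xs = N \<and> set xs \<subseteq> A}"

definition cost_seq :: "('s \<Rightarrow> real) \<Rightarrow> 's list \<Rightarrow> real" where
  "cost_seq c ss = (\<Sum>i<length ss. c (ss ! i)) / real (length ss)"

text \<open>Random code of length N with message set {..<Mn}: a finite family of deterministic codes
  (f g, phi g), indexed by g in the finite set G, chosen with probability pi g.\<close>
definition random_code ::
  "nat \<Rightarrow> nat \<Rightarrow> nat set \<Rightarrow> (nat \<Rightarrow> real) \<Rightarrow> (nat \<Rightarrow> nat \<Rightarrow> 'x list) \<Rightarrow> (nat \<Rightarrow> 'y list \<Rightarrow> nat) \<Rightarrow> bool" where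
  "random_code N Mn G \<pi> f \<phi> \<longleftrightarrow>
     0 < Mn \<and> finite G \<and> (\<forall>g\<in>G. 0 \<le> \<pi> g) \<and> (\<Sum>g\<in>G. \<pi> g) = 1 \<and>
     (\<forall>g\<in>G. \<forall>m<Mn. length (f g m) = N) \<and>
     (\<forall>g\<in>G. \<forall>ys\<in>seqs N UNIV. \<phi> g ys < Mn)"

definition max_err ::
  "('s \<Rightarrow> 'x \<Rightarrow> 'y::finite \<Rightarrow> real) \<Rightarrow> nat \<Rightarrow> nat \<Rightarrow> nat set \<Rightarrow> (nat \<Rightarrow> real) \<Rightarrow>
   (nat \<Rightarrow> nat \<Rightarrow> 'x list) \<Rightarrow> (nat \<Rightarrow> 'y list \<Rightarrow> nat) \<Rightarrow> 's list \<Rightarrow> real" where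
  "max_err W N Mn G \<pi> f \<phi> ss =
     Max ((\<lambda>m. \<Sum>g\<in>G. \<pi> g *
              (1 - (\<Sum>ys\<in>{ys\<in>seqs N UNIV. \<phi> g ys = m}. block_prob W ys (f g m) ss))) ` {..<Mn})"

text \<open>Joint pmf of (M, Z^N(ss), Phi), Phi being the decoder restricted to Y^N.\<close>
definition secrecy_joint ::
  "('s \<Rightarrow> 'x \<Rightarrow> 'z \<Rightarrow> real) \<Rightarrow> nat \<Rightarrow> nat \<Rightarrow> nat set \<Rightarrow> (nat \<Rightarrow> real) \<Rightarrow>
   (nat \<Rightarrow> nat \<Rightarrow> 'x list) \<Rightarrow> (nat \<Rightarrow> 'y::finite list \<Rightarrow> nat) \<Rightarrow> 's list \<Rightarrow>
   nat \<Rightarrow> 'z list \<Rightarrow> ('y list \<Rightarrow> nat) \<Rightarrow> real" where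
  "secrecy_joint V N Mn G \<pi> f \<phi> ss m zs d =
     (\<Sum>g\<in>{g\<in>G. restrict (\<phi> g) (seqs N UNIV) = d}. \<pi> g * (1 / real Mn) * block_prob V zs (f g m) ss)"

definition secrecy_leak ::
  "('s \<Rightarrow> 'x \<Rightarrow> 'z::finite \<Rightarrow> real) \<Rightarrow> nat \<Rightarrow> nat \<Rightarrow> nat set \<Rightarrow> (nat \<Rightarrow> real) \<Rightarrow>
   (nat \<Rightarrow> nat \<Rightarrow> 'x list) \<Rightarrow> (nat \<Rightarrow> 'y::finite list \<Rightarrow> nat) \<Rightarrow> 's list \<Rightarrow> real" where
  "secrecy_leak V N Mn G \<pi> f \<phi> ss =
     cond_mutual_info {..<Mn} (seqs N UNIV) ((\<lambda>g. restrict (\<phi> g) (seqs N UNIV)) ` G)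
       (secrecy_joint V N Mn G \<pi> f \<phi> ss)"

definition achievable_random ::
  "('s::finite \<Rightarrow> 'x::finite \<Rightarrow> 'y::finite \<Rightarrow> real) \<Rightarrow> ('s \<Rightarrow> 'x \<Rightarrow> 'z::finite \<Rightarrow> real) \<Rightarrow>
   ('s \<Rightarrow> real) \<Rightarrow> real \<Rightarrow> real \<Rightarrow> bool" where
  "achievable_random W V c \<Lambda> R \<longleftrightarrow> 0 \<le> R \<and>
     (\<forall>\<epsilon>>0. \<exists>N0. \<forall>N\<ge>N0. \<exists>Mn G \<pi> f (\<phi> :: nat \<Rightarrow> 'y list \<Rightarrow> nat).
        random_code N Mn G \<pi> f \<phi> \<and>
        log 2 (real Mn) / real N > R - \<epsilon> \<and>
        (\<forall>ss\<in>seqs N UNIV. cost_seq c ss \<le> \<Lambda> \<longrightarrow> max_err W N Mn G \<pi> f \<phi> ss < \<epsilon>) \<and>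
        (\<forall>ss\<in>seqs N UNIV. cost_seq c ss \<le> \<Lambda> \<longrightarrow> secrecy_leak V N Mn G \<pi> f \<phi> ss < \<epsilon>))"

end

theory Submission
  imports Defs "HOL-Real_Asymp.Real_Asymp"
begin

text \<open>
  The common randomness is a codebook of i.i.d. words \<open>U\<^sup>N(m, l)\<close>; the sender picks \<open>l\<close> uniformly
  and passes the word through the test channel \<open>P(x|u)\<close>. Since the leakage is averaged over the
  codebook, no state sequence has to be treated uniformly: by convexity it is at most the expected
  divergence of the output of a random subcodebook from the product output distribution, and soft
  covering makes this exponentially small once the rate of \<open>l\<close> exceeds the average of
  \<open>I(U;Z\<^sub>s)\<close> over the empirical distribution of the state sequence.

  The decoder compares a single additive score with a threshold. The score is the information
  density of a channel \<open>W\<^sub>q\<close>, slightly perturbed by noise, that nearly minimises \<open>I(U;Y\<^sub>q)\<close>. As the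
  admissible \<open>q\<close> form a convex set, the first-order optimality condition gives the score a mean of
  nearly the minimum under every admissible \<open>q\<close>, in particular under the empirical distribution of
  every admissible state sequence, whereas a wrong codeword exceeds the threshold \<open>a\<close> with
  probability at most \<open>exp (- a)\<close> whatever the state sequence is. Both tails are controlled by
  Chernoff bounds, so no method of types is needed.
\<close>

section \<open>Weighted means over finite sets\<close>

definition mean :: "'a set \<Rightarrow> ('a \<Rightarrow> real) \<Rightarrow> ('a \<Rightarrow> real) \<Rightarrow> real" where
  "mean A p f = (\<Sum>a\<in>A. p a * f a)"

definition prob_on :: "'a set \<Rightarrow> ('a \<Rightarrow> real) \<Rightarrow> bool" where
  "prob_on A p \<longleftrightarrow> finite A \<and> (\<forall>a\<in>A. 0 \<le> p a) \<and> sum p A = 1"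

definition kernel_on :: "'a set \<Rightarrow> 'b set \<Rightarrow> ('a \<Rightarrow> 'b \<Rightarrow> real) \<Rightarrow> bool" where
  "kernel_on A B w \<longleftrightarrow> (\<forall>a\<in>A. prob_on B (w a))"

definition joint_mean ::
  "'a set \<Rightarrow> 'b set \<Rightarrow> ('a \<Rightarrow> real) \<Rightarrow> ('a \<Rightarrow> 'b \<Rightarrow> real) \<Rightarrow> ('a \<Rightarrow> 'b \<Rightarrow> real) \<Rightarrow> real" where
  "joint_mean A B p w f = mean A p (\<lambda>a. mean B (w a) (f a))"

definition output_prob :: "'a set \<Rightarrow> ('a \<Rightarrow> real) \<Rightarrow> ('a \<Rightarrow> 'b \<Rightarrow> real) \<Rightarrow> 'b \<Rightarrow> real" where
  "output_prob A p w b = mean A p (\<lambda>a. w a b)"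

definition unif :: "'a set \<Rightarrow> 'a \<Rightarrow> real" where
  "unif A a = 1 / real (card A)"

definition mix :: "real \<Rightarrow> ('a \<Rightarrow> 'b \<Rightarrow> real) \<Rightarrow> ('a \<Rightarrow> 'b \<Rightarrow> real) \<Rightarrow> 'a \<Rightarrow> 'b \<Rightarrow> real" where
  "mix t w w' a b = (1 - t) * w a b + t * w' a b"

lemma prob_on_finite: "prob_on A p \<Longrightarrow> finite A"
  and prob_on_nonneg: "prob_on A p \<Longrightarrow> a \<in> A \<Longrightarrow> 0 \<le> p a"
  and prob_on_sum: "prob_on A p \<Longrightarrow> sum p A = 1"
  by (simp_all add: prob_on_def)

lemma prob_on_le_1: "prob_on A p \<Longrightarrow> a \<in> A \<Longrightarrow> p a \<le> 1"
  using member_le_sum[of a A p] by (auto simp: prob_on_def)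

lemma kernel_onD: "kernel_on A B w \<Longrightarrow> a \<in> A \<Longrightarrow> prob_on B (w a)"
  by (simp add: kernel_on_def)

lemma kernel_on_nonneg: "kernel_on A B w \<Longrightarrow> a \<in> A \<Longrightarrow> b \<in> B \<Longrightarrow> 0 \<le> w a b"
  by (simp add: kernel_on_def prob_on_def)

lemma mean_cong: "(\<And>a. a \<in> A \<Longrightarrow> p a \<noteq> 0 \<Longrightarrow> f a = g a) \<Longrightarrow> mean A p f = mean A p g"
  unfolding mean_def by (rule sum.cong) auto

lemma mean_mono:
  assumes "\<And>a. a \<in> A \<Longrightarrow> 0 \<le> p a" and "\<And>a. a \<in> A \<Longrightarrow> 0 < p a \<Longrightarrow> f a \<le> g a"
  shows "mean A p f \<le> mean A p g"
  unfolding mean_def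
proof (rule sum_mono)
  fix a assume "a \<in> A"
  then show "p a * f a \<le> p a * g a"
    using assms by (cases "p a = 0") (auto intro!: mult_left_mono simp: order_less_le)
qed

lemma mean_zero [simp]: "mean A p (\<lambda>_. 0) = 0"
  by (simp add: mean_def)

lemma mean_nonneg:
  assumes "\<And>a. a \<in> A \<Longrightarrow> 0 \<le> p a" and "\<And>a. a \<in> A \<Longrightarrow> 0 < p a \<Longrightarrow> 0 \<le> f a"
  shows "0 \<le> mean A p f"
  using mean_mono[of A p "\<lambda>_. 0" f] assms by simp

lemma mean_const: "prob_on A p \<Longrightarrow> mean A p (\<lambda>_. x) = x"
  by (simp add: mean_def prob_on_def sum_distrib_right[symmetric])

lemma mean_add: "mean A p (\<lambda>a. f a + g a) = mean A p f + mean A p g"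
  and mean_diff: "mean A p (\<lambda>a. f a - g a) = mean A p f - mean A p g"
  and mean_cmult: "mean A p (\<lambda>a. x * f a) = x * mean A p f"
  by (simp_all add: mean_def algebra_simps sum.distrib sum_subtractf sum_distrib_left)

lemma mean_divide: "mean A p (\<lambda>a. f a / x) = mean A p f / x"
  by (simp add: mean_def sum_divide_distrib)

lemma mean_mult_weight: "mean A (\<lambda>a. p a * g a) f = mean A p (\<lambda>a. g a * f a)"
  by (simp add: mean_def mult.assoc)

lemma mean_sum: "mean A p (\<lambda>a. \<Sum>i\<in>I. f i a) = (\<Sum>i\<in>I. mean A p (f i))"
  unfolding mean_def sum_distrib_left by (rule sum.swap)

lemma mean_swap: "mean A p (\<lambda>a. mean B q (f a)) = mean B q (\<lambda>b. mean A p (\<lambda>a. f a b))"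
  unfolding mean_def sum_distrib_left by (subst sum.swap) (simp add: mult.left_commute)

lemma joint_mean_mono:
  assumes "prob_on A p" and "kernel_on A B w"
    and "\<And>a b. a \<in> A \<Longrightarrow> b \<in> B \<Longrightarrow> 0 < p a \<Longrightarrow> 0 < w a b \<Longrightarrow> f a b \<le> g a b"
  shows "joint_mean A B p w f \<le> joint_mean A B p w g"
  unfolding joint_mean_def
  using assms by (intro mean_mono) (auto intro: prob_on_nonneg kernel_on_nonneg)

lemma joint_mean_const:
  assumes "prob_on A p" and "kernel_on A B w"
  shows "joint_mean A B p w (\<lambda>_ _. x) = x"
proof -
  have "joint_mean A B p w (\<lambda>_ _. x) = mean A p (\<lambda>_. x)"
    unfolding joint_mean_def using assms(2) by (intro mean_cong mean_const) (rule kernel_onD)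
  then show ?thesis using assms(1) by (simp add: mean_const)
qed

lemma joint_mean_cmult: "joint_mean A B p w (\<lambda>a b. x * f a b) = x * joint_mean A B p w f"
  by (simp add: joint_mean_def mean_cmult)

lemma joint_mean_add:
  "joint_mean A B p w (\<lambda>a b. f a b + g a b)
    = joint_mean A B p w f + joint_mean A B p w g"
  by (simp add: joint_mean_def mean_add)

lemma joint_mean_mix:
  "joint_mean A B p (mix t w w') f = (1 - t) * joint_mean A B p w f + t * joint_mean A B p w' f"
proof -
  have "mean B (mix t w w' a) (f a) = (1 - t) * mean B (w a) (f a) + t * mean B (w' a) (f a)" for a
    by (simp add: mean_def mix_def ring_distribs sum.distrib sum_distrib_left mult.assoc)
  then show ?thesis by (simp add: joint_mean_def mean_add mean_cmult)
qed

lemma mean_Times: "mean (A \<times> B) (\<lambda>(a, b). p a * w a b) (\<lambda>(a, b). f a b) = joint_mean A B p w f"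
  by (simp add: joint_mean_def mean_def sum.cartesian_product sum_distrib_left mult.assoc split_def)

lemma prob_on_Times:
  assumes "prob_on A p" and "kernel_on A B w" and "finite B"
  shows "prob_on (A \<times> B) (\<lambda>(a, b). p a * w a b)"
proof -
  have "sum (\<lambda>(a, b). p a * w a b) (A \<times> B) = joint_mean A B p w (\<lambda>_ _. 1)"
    unfolding mean_Times[symmetric] by (simp add: mean_def split_def)
  also have "\<dots> = 1" by (rule joint_mean_const[OF assms(1,2)])
  finally show ?thesis
    using assms by (auto simp: prob_on_def kernel_on_def)
qed

lemma mean_output_prob: "mean B (output_prob A p w) f = joint_mean A B p w (\<lambda>_. f)"
  unfolding mean_def output_prob_def joint_mean_def sum_distrib_left sum_distrib_right
  by (subst sum.swap) (simp add: mult.assoc)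

lemma output_prob_output_prob:
  "output_prob B (output_prob A p w) v = output_prob A p (\<lambda>a. output_prob B (w a) v)"
  by (simp add: fun_eq_iff output_prob_def[of B] output_prob_def[of A p "\<lambda>a. output_prob B (w a) v"]
      mean_output_prob joint_mean_def)

lemma prob_on_output_prob:
  assumes "prob_on A p" and "kernel_on A B w" and "finite B"
  shows "prob_on B (output_prob A p w)"
proof -
  have "sum (output_prob A p w) B = joint_mean A B p w (\<lambda>_ _. 1)"
    unfolding mean_output_prob[symmetric] by (simp add: mean_def)
  moreover have "0 \<le> output_prob A p w b" if "b \<in> B" for b
    unfolding output_prob_def
    using assms that by (intro mean_nonneg) (auto intro: prob_on_nonneg kernel_on_nonneg)
  ultimately show ?thesis using assms by (simp add: prob_on_def[of B] joint_mean_const)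
qed

lemma output_prob_pos:
  assumes "prob_on A p" and "kernel_on A B w" and "a \<in> A" "b \<in> B" and "0 < p a" "0 < w a b"
  shows "0 < output_prob A p w b"
proof -
  have "p a * w a b \<le> output_prob A p w b"
    unfolding output_prob_def mean_def
    using assms by (intro member_le_sum) (auto simp: kernel_on_def prob_on_def)
  then show ?thesis using assms by (meson less_le_trans mult_pos_pos)
qed

lemma output_prob_ge:
  assumes "prob_on A p" and "\<And>a. a \<in> A \<Longrightarrow> x \<le> w a b"
  shows "x \<le> output_prob A p w b"
  using mean_mono[of A p "\<lambda>_. x" "\<lambda>a. w a b"] assms
  by (simp add: output_prob_def mean_const prob_on_nonneg)

lemma prob_on_unif: "finite A \<Longrightarrow> A \<noteq> {} \<Longrightarrow> prob_on A (unif A)"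
  by (simp add: prob_on_def unif_def)

lemma kernel_on_unif: "finite B \<Longrightarrow> B \<noteq> {} \<Longrightarrow> kernel_on A B (\<lambda>_. unif B)"
  by (simp add: kernel_on_def prob_on_unif)

lemma kernel_on_mix:
  assumes "kernel_on A B w" "kernel_on A B w'" "0 \<le> t" "t \<le> 1"
  shows "kernel_on A B (mix t w w')"
  using assms
  by (auto simp: kernel_on_def prob_on_def mix_def sum.distrib sum_distrib_left[symmetric])

lemma mean_ln_le_mean_ln:
  assumes p: "\<And>a. a \<in> A \<Longrightarrow> 0 \<le> p a"
    and pos: "\<And>a. a \<in> A \<Longrightarrow> 0 < p a \<Longrightarrow> 0 < x a" "\<And>a. a \<in> A \<Longrightarrow> 0 < p a \<Longrightarrow> 0 < y a"
    and ratio: "mean A p (\<lambda>a. x a / y a) \<le> sum p A"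
  shows "mean A p (\<lambda>a. ln (x a)) \<le> mean A p (\<lambda>a. ln (y a))"
proof -
  have "mean A p (\<lambda>a. ln (x a)) \<le> mean A p (\<lambda>a. ln (y a) + (x a / y a - 1))"
  proof (rule mean_mono[OF p])
    fix a assume "a \<in> A" "0 < p a"
    then have "0 < x a" "0 < y a" using pos by auto
    then show "ln (x a) \<le> ln (y a) + (x a / y a - 1)"
      using ln_le_minus_one[of "x a / y a"] by (simp add: ln_divide_pos)
  qed
  also have "\<dots> = mean A p (\<lambda>a. ln (y a)) + mean A p (\<lambda>a. x a / y a) - sum p A"
    unfolding mean_add mean_diff by (simp add: mean_def)
  finally show ?thesis using ratio by simp
qed

section \<open>Product distributions\<close>

definition word_prob :: "nat \<Rightarrow> (nat \<Rightarrow> 'a \<Rightarrow> real) \<Rightarrow> 'a list \<Rightarrow> real" where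
  "word_prob N p xs = (\<Prod>i<N. p i (xs ! i))"

definition word_kernel :: "nat \<Rightarrow> (nat \<Rightarrow> 'a \<Rightarrow> 'b \<Rightarrow> real) \<Rightarrow> 'a list \<Rightarrow> 'b list \<Rightarrow> real" where
  "word_kernel N w xs = word_prob N (\<lambda>i. w i (xs ! i))"

definition prod_prob :: "'i set \<Rightarrow> ('i \<Rightarrow> 'a \<Rightarrow> real) \<Rightarrow> ('i \<Rightarrow> 'a) \<Rightarrow> real" where
  "prod_prob J w C = (\<Prod>j\<in>J. w j (C j))"

lemma seqs_nth: "xs \<in> seqs N A \<Longrightarrow> i < N \<Longrightarrow> xs ! i \<in> A"
  by (auto simp: seqs_def)

lemma finite_seqs: "finite A \<Longrightarrow> finite (seqs N A)"
  unfolding seqs_def by (rule finite_subset[OF _ finite_lists_length_eq[of A N]]) auto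

lemma seqs_Suc: "seqs (Suc N) A = (\<lambda>(a, xs). a # xs) ` (A \<times> seqs N A)"
proof (intro set_eqI iffI)
  fix xs assume "xs \<in> seqs (Suc N) A"
  then show "xs \<in> (\<lambda>(a, xs). a # xs) ` (A \<times> seqs N A)"
    by (cases xs) (auto simp: seqs_def)
qed (auto simp: seqs_def)

lemma sum_seqs_prod:
  fixes g :: "nat \<Rightarrow> 'a \<Rightarrow> real"
  shows "(\<Sum>xs\<in>seqs N A. \<Prod>i<N. g i (xs ! i)) = (\<Prod>i<N. \<Sum>a\<in>A. g i a)"
proof (induction N arbitrary: g)
  case 0
  have "seqs 0 A = {[]}" by (auto simp: seqs_def)
  then show ?case by simp
next
  case (Suc N)
  have inj: "inj_on (\<lambda>(a, xs). a # xs) (A \<times> seqs N A)"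
    by (auto simp: inj_on_def)
  have "(\<Sum>xs\<in>seqs (Suc N) A. \<Prod>i<Suc N. g i (xs ! i))
      = (\<Sum>(a, xs)\<in>A \<times> seqs N A. g 0 a * (\<Prod>i<N. g (Suc i) (xs ! i)))"
    unfolding seqs_Suc sum.reindex[OF inj]
    by (auto intro!: sum.cong simp: prod.lessThan_Suc_shift simp del: prod.lessThan_Suc)
  also have "\<dots> = (\<Sum>a\<in>A. g 0 a) * (\<Sum>xs\<in>seqs N A. \<Prod>i<N. g (Suc i) (xs ! i))"
    by (simp add: sum.cartesian_product[symmetric] sum_product)
  also have "\<dots> = (\<Prod>i<Suc N. \<Sum>a\<in>A. g i a)"
    by (subst Suc.IH) (simp add: prod.lessThan_Suc_shift del: prod.lessThan_Suc)
  finally show ?case .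
qed

lemma mean_word_prob:
  "mean (seqs N A) (word_prob N p) (\<lambda>xs. \<Prod>i<N. f i (xs ! i)) = (\<Prod>i<N. mean A (p i) (f i))"
  unfolding mean_def word_prob_def prod.distrib[symmetric] by (rule sum_seqs_prod)

lemma joint_mean_word:
  "joint_mean (seqs N A) (seqs N B) (word_prob N p) (word_kernel N w)
       (\<lambda>xs ys. \<Prod>i<N. f i (xs ! i) (ys ! i))
     = (\<Prod>i<N. joint_mean A B (p i) (w i) (f i))"
  unfolding joint_mean_def word_kernel_def
  by (simp only: mean_word_prob[where f = "\<lambda>i. f i (_ ! i)"]
      mean_word_prob[where f = "\<lambda>i a. mean B (w i a) (f i a)"])

lemma output_prob_word:
  "output_prob (seqs N A) (word_prob N p) (word_kernel N w)
      = word_prob N (\<lambda>i. output_prob A (p i) (w i))"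
proof
  fix ys
  show "output_prob (seqs N A) (word_prob N p) (word_kernel N w) ys
      = word_prob N (\<lambda>i. output_prob A (p i) (w i)) ys"
    unfolding output_prob_def word_kernel_def word_prob_def[of N _ ys] by (rule mean_word_prob)
qed

lemma prob_on_word_prob:
  assumes "finite A" and "\<And>i. i < N \<Longrightarrow> prob_on A (p i)"
  shows "prob_on (seqs N A) (word_prob N p)"
  using assms
  by (auto simp: prob_on_def word_prob_def finite_seqs sum_seqs_prod seqs_nth intro!: prod_nonneg)

lemma word_prob_pos:
  assumes "\<And>i a. i < N \<Longrightarrow> a \<in> A \<Longrightarrow> 0 < p i a" and "xs \<in> seqs N A"
  shows "0 < word_prob N p xs"
  unfolding word_prob_def using assms(1) seqs_nth[OF assms(2)] by (intro prod_pos) simp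

lemma kernel_on_word_kernel:
  assumes "finite B" and "\<And>i. i < N \<Longrightarrow> kernel_on A B (w i)"
  shows "kernel_on (seqs N A) (seqs N B) (word_kernel N w)"
  using assms by (auto simp: kernel_on_def word_kernel_def seqs_nth intro!: prob_on_word_prob)

lemma prob_on_prod_prob:
  assumes "finite J" and "\<And>j. j \<in> J \<Longrightarrow> prob_on (A j) (w j)"
  shows "prob_on (PiE J A) (prod_prob J w)"
  unfolding prob_on_def
proof (intro conjI ballI)
  show "finite (PiE J A)" using assms by (auto intro: finite_PiE prob_on_finite)
  show "0 \<le> prod_prob J w C" if "C \<in> PiE J A" for C
    unfolding prod_prob_def using that by (intro prod_nonneg ballI prob_on_nonneg[OF assms(2)]) auto
  have "(\<Sum>C\<in>PiE J A. prod_prob J w C) = (\<Prod>j\<in>J. \<Sum>a\<in>A j. w j a)"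
    unfolding prod_prob_def
    by (rule prod_sum_PiE[symmetric]) (use assms in \<open>auto intro: prob_on_finite\<close>)
  then show "sum (prod_prob J w) (PiE J A) = 1" using assms by (simp add: prob_on_sum)
qed

lemma mean_prod_prob_insert:
  assumes "finite J" "i \<notin> J"
  shows "mean (PiE (insert i J) A) (prod_prob (insert i J) w) F
       = mean (A i) (w i) (\<lambda>a. mean (PiE J A) (prod_prob J w) (\<lambda>C. F (C(i := a))))"
proof -
  have "prod_prob (insert i J) w (C(i := a)) = w i a * prod_prob J w C" for C a
    unfolding prod_prob_def using assms by (auto intro!: prod.cong)
  then have "mean (PiE (insert i J) A) (prod_prob (insert i J) w) F
      = (\<Sum>(a, C)\<in>A i \<times> PiE J A. w i a * prod_prob J w C * F (C(i := a)))"
    unfolding mean_def PiE_insert_eq sum.reindex[OF inj_combinator[OF assms(2)]]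
    by (auto intro!: sum.cong)
  then show ?thesis
    by (simp add: mean_def sum.cartesian_product[symmetric] sum_distrib_left mult.assoc)
qed

lemma mean_prod_prob_coordinate:
  assumes "finite J" "\<And>j. j \<in> J \<Longrightarrow> prob_on (A j) (w j)" "i \<in> J"
  shows "mean (PiE J A) (prod_prob J w) (\<lambda>C. h (C i)) = mean (A i) (w i) h"
proof -
  have "J = insert i (J - {i})" using assms by auto
  moreover have "prob_on (PiE (J - {i}) A) (prod_prob (J - {i}) w)"
    using assms by (intro prob_on_prod_prob) auto
  ultimately show ?thesis
    using mean_prod_prob_insert[of "J - {i}" i A w "\<lambda>C. h (C i)"] assms(1) by (simp add: mean_const)
qed

lemma mean_prod_prob_coordinates:
  assumes "finite J" "\<And>j. j \<in> J \<Longrightarrow> prob_on (A j) (w j)" "i \<in> J" "k \<in> J" "i \<noteq> k"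
  shows "mean (PiE J A) (prod_prob J w) (\<lambda>C. h (C i) (C k))
      = mean (A i) (w i) (\<lambda>a. mean (A k) (w k) (h a))"
proof -
  have "J = insert i (J - {i})" using assms by auto
  then have "mean (PiE J A) (prod_prob J w) (\<lambda>C. h (C i) (C k))
      = mean (A i) (w i) (\<lambda>a. mean (PiE (J - {i}) A) (prod_prob (J - {i}) w) (\<lambda>C. h a (C k)))"
    using mean_prod_prob_insert[of "J - {i}" i A w "\<lambda>C. h (C i) (C k)"] assms by simp
  also have "\<dots> = mean (A i) (w i) (\<lambda>a. mean (A k) (w k) (h a))"
    using assms by (intro mean_cong mean_prod_prob_coordinate) auto
  finally show ?thesis .
qed

section \<open>Relative entropy and mutual information\<close>

definition abs_cont_on :: "'b set \<Rightarrow> ('b \<Rightarrow> real) \<Rightarrow> ('b \<Rightarrow> real) \<Rightarrow> bool" where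
  "abs_cont_on B p q \<longleftrightarrow> (\<forall>b\<in>B. q b = 0 \<longrightarrow> p b = 0)"

text \<open>Where \<open>q\<close> vanishes but \<open>p\<close> does not, the summand is \<open>0\<close> instead of infinite, hence the
  hypotheses of absolute continuity below.\<close>

definition rel_entropy :: "'b set \<Rightarrow> ('b \<Rightarrow> real) \<Rightarrow> ('b \<Rightarrow> real) \<Rightarrow> real" where
  "rel_entropy B p q = mean B p (\<lambda>b. ln (p b / q b))"

definition mi_nats :: "'a set \<Rightarrow> 'b set \<Rightarrow> ('a \<Rightarrow> real) \<Rightarrow> ('a \<Rightarrow> 'b \<Rightarrow> real) \<Rightarrow> real" where
  "mi_nats A B p w = mean A p (\<lambda>a. rel_entropy B (w a) (output_prob A p w))"

definition info_density :: "'a set \<Rightarrow> ('a \<Rightarrow> real) \<Rightarrow> ('a \<Rightarrow> 'b \<Rightarrow> real) \<Rightarrow> 'a \<Rightarrow> 'b \<Rightarrow> real" where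
  "info_density A p w a b = ln (w a b / output_prob A p w b)"

lemma abs_cont_on_output_prob:
  assumes "prob_on A p" "kernel_on A B w" "a \<in> A" "0 < p a"
  shows "abs_cont_on B (w a) (output_prob A p w)"
  unfolding abs_cont_on_def
  using output_prob_pos[OF assms(1-3)] kernel_on_nonneg[OF assms(2,3)] assms(4)
  by (metis less_irrefl order_le_less)

lemma abs_cont_on_imp_pos:
  assumes "abs_cont_on B p q" and "prob_on B q" and "b \<in> B" and "0 < p b"
  shows "0 < q b"
  using assms by (metis abs_cont_on_def less_irrefl order_le_less prob_on_nonneg)

lemma mi_nats_eq_mean_info_density: "mi_nats A B p w = joint_mean A B p w (info_density A p w)"
  by (simp add: mi_nats_def rel_entropy_def joint_mean_def info_density_def[abs_def])

lemma rel_entropy_nonneg: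
  assumes p: "prob_on B p" and q: "prob_on B q" and ac: "abs_cont_on B p q"
  shows "0 \<le> rel_entropy B p q"
proof -
  have pos: "0 < q b" if "b \<in> B" "0 < p b" for b
    using ac q that by (rule abs_cont_on_imp_pos)
  have "p b * (q b / p b) \<le> q b" if "b \<in> B" for b
    using prob_on_nonneg[OF q that] by simp
  then have "mean B p (\<lambda>b. q b / p b) \<le> sum q B"
    unfolding mean_def by (rule sum_mono)
  then have "mean B p (\<lambda>b. ln (q b)) \<le> mean B p (\<lambda>b. ln (p b))"
    using p q pos by (intro mean_ln_le_mean_ln) (auto simp: prob_on_sum intro: prob_on_nonneg)
  moreover have "rel_entropy B p q = mean B p (\<lambda>b. ln (p b) - ln (q b))"
    unfolding rel_entropy_def
  proof (rule mean_cong)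
    fix b assume b: "b \<in> B" "p b \<noteq> 0"
    then have "0 < p b" using prob_on_nonneg[OF p] by (simp add: order_less_le)
    then show "ln (p b / q b) = ln (p b) - ln (q b)"
      using pos[OF b(1)] by (simp add: ln_divide_pos)
  qed
  ultimately show ?thesis by (simp add: mean_diff)
qed

lemma mi_nats_nonneg:
  assumes p: "prob_on A p" and w: "kernel_on A B w" and "finite B"
  shows "0 \<le> mi_nats A B p w"
  unfolding mi_nats_def
proof (rule mean_nonneg)
  fix a assume "a \<in> A" "0 < p a"
  then show "0 \<le> rel_entropy B (w a) (output_prob A p w)"
    using rel_entropy_nonneg[OF kernel_onD[OF w] prob_on_output_prob[OF assms]
        abs_cont_on_output_prob[OF p w]]
    by blast
qed (use p in \<open>rule prob_on_nonneg\<close>)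

text \<open>This compensation identity gives both the golden formula for mutual information and the
  convexity of relative entropy.\<close>

lemma mean_rel_entropy:
  assumes p: "prob_on A p" and w: "kernel_on A B w" and q: "prob_on B q"
    and ac: "\<And>a. a \<in> A \<Longrightarrow> 0 < p a \<Longrightarrow> abs_cont_on B (w a) q"
  shows "mean A p (\<lambda>a. rel_entropy B (w a) q)
      = mi_nats A B p w + rel_entropy B (output_prob A p w) q"
proof -
  let ?r = "output_prob A p w"
  have "mean A p (\<lambda>a. rel_entropy B (w a) q) - mi_nats A B p w
      = joint_mean A B p w (\<lambda>a b. ln (w a b / q b) - ln (w a b / ?r b))"
    by (simp add: mi_nats_def rel_entropy_def joint_mean_def mean_diff)
  also have "\<dots> = joint_mean A B p w (\<lambda>_ b. ln (?r b / q b))"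
    unfolding joint_mean_def
  proof (intro mean_cong)
    fix a b assume ab: "a \<in> A" "p a \<noteq> 0" "b \<in> B" "w a b \<noteq> 0"
    then have pos: "0 < p a" "0 < w a b"
      using prob_on_nonneg[OF p] kernel_on_nonneg[OF w] by (auto simp: order_less_le)
    have "0 < q b" using abs_cont_on_imp_pos[OF ac q] ab pos by blast
    moreover have "0 < ?r b" using output_prob_pos[OF p w] ab pos by blast
    ultimately show "ln (w a b / q b) - ln (w a b / ?r b) = ln (?r b / q b)"
      using pos by (simp add: ln_divide_pos)
  qed
  finally show ?thesis by (simp add: rel_entropy_def mean_output_prob)
qed

lemma
  assumes p: "prob_on A p" and w: "kernel_on A B w" and q: "prob_on B q"
    and ac: "\<And>a. a \<in> A \<Longrightarrow> 0 < p a \<Longrightarrow> abs_cont_on B (w a) q"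
  shows mi_nats_le_mean_rel_entropy: "mi_nats A B p w \<le> mean A p (\<lambda>a. rel_entropy B (w a) q)"
    and rel_entropy_output_prob_le:
      "rel_entropy B (output_prob A p w) q \<le> mean A p (\<lambda>a. rel_entropy B (w a) q)"
proof -
  have out: "prob_on B (output_prob A p w)"
    using p w prob_on_finite[OF q] by (rule prob_on_output_prob)
  have "abs_cont_on B (output_prob A p w) q"
    using ac prob_on_nonneg[OF p]
    by (force simp: abs_cont_on_def output_prob_def mean_def order_less_le intro!: sum.neutral)
  with out q have "0 \<le> rel_entropy B (output_prob A p w) q" by (rule rel_entropy_nonneg)
  then show "mi_nats A B p w \<le> mean A p (\<lambda>a. rel_entropy B (w a) q)"
    using mean_rel_entropy[OF assms] by simp
  have "0 \<le> mi_nats A B p w" using p w prob_on_finite[OF q] by (rule mi_nats_nonneg)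
  then show "rel_entropy B (output_prob A p w) q \<le> mean A p (\<lambda>a. rel_entropy B (w a) q)"
    using mean_rel_entropy[OF assms] by simp
qed

lemma mutual_info_mono_neutral:
  assumes "finite A" "A' \<subseteq> A" and "\<And>a b. a \<in> A - A' \<Longrightarrow> b \<in> B \<Longrightarrow> Q a b = 0"
  shows "mutual_info A B Q = mutual_info A' B Q"
proof -
  have column: "(\<Sum>a\<in>A. Q a b) = (\<Sum>a\<in>A'. Q a b)" if "b \<in> B" for b
    using assms that by (intro sum.mono_neutral_right) auto
  have "mutual_info A B Q = (\<Sum>a\<in>A'. \<Sum>b\<in>B. if Q a b = 0 then 0
      else Q a b * log 2 (Q a b / ((\<Sum>b'\<in>B. Q a b') * (\<Sum>a'\<in>A. Q a' b))))"
    unfolding mutual_info_def using assms by (intro sum.mono_neutral_right) auto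
  also have "\<dots> = mutual_info A' B Q"
    unfolding mutual_info_def by (intro sum.cong refl) (simp add: column)
  finally show ?thesis .
qed

lemma mutual_info_eq_mi_nats:
  assumes p: "prob_on A p" and w: "kernel_on A B w"
    and P: "\<And>a b. a \<in> A \<Longrightarrow> b \<in> B \<Longrightarrow> P a b = p a * w a b"
  shows "mutual_info A B P = mi_nats A B p w / ln 2"
proof -
  have row: "(\<Sum>b\<in>B. P a b) = p a" if "a \<in> A" for a
    using P[OF that] prob_on_sum[OF kernel_onD[OF w that]]
    by (simp add: sum_distrib_left[symmetric])
  have column: "(\<Sum>a\<in>A. P a b) = output_prob A p w b" if "b \<in> B" for b
    using P that by (simp add: output_prob_def mean_def)
  have "mutual_info A B P = (\<Sum>a\<in>A. \<Sum>b\<in>B. p a * (w a b * info_density A p w a b) / ln 2)"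
    unfolding mutual_info_def
    by (intro sum.cong refl) (simp only: row column, simp add: P info_density_def log_def)
  then show ?thesis
    by (simp add: mi_nats_eq_mean_info_density joint_mean_def mean_def sum_distrib_left
        sum_divide_distrib)
qed

lemma cond_mutual_info_eq_mi_nats:
  assumes \<nu>: "prob_on M \<nu>" and w: "\<And>d. d \<in> D \<Longrightarrow> kernel_on M Z (w d)" and \<rho>: "\<And>d. d \<in> D \<Longrightarrow> 0 < \<rho> d"
    and P: "\<And>m z d. m \<in> M \<Longrightarrow> z \<in> Z \<Longrightarrow> d \<in> D \<Longrightarrow> P m z d = \<rho> d * (\<nu> m * w d m z)"
  shows "cond_mutual_info M Z D P = (\<Sum>d\<in>D. \<rho> d * mi_nats M Z \<nu> (w d)) / ln 2"
proof -
  have sum_Z: "(\<Sum>z\<in>Z. P m z d) = \<rho> d * \<nu> m" if "m \<in> M" "d \<in> D" for m d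
    using P[OF that(1) _ that(2)] prob_on_sum[OF kernel_onD[OF w[OF that(2)] that(1)]]
    by (simp add: sum_distrib_left[symmetric])
  have sum_M: "(\<Sum>m\<in>M. P m z d) = \<rho> d * output_prob M \<nu> (w d) z" if "z \<in> Z" "d \<in> D" for z d
    using P that by (simp add: output_prob_def mean_def sum_distrib_left)
  have sum_MZ: "(\<Sum>m\<in>M. \<Sum>z\<in>Z. P m z d) = \<rho> d" if "d \<in> D" for d
    using prob_on_sum[OF \<nu>] that by (simp add: sum_Z sum_distrib_left[symmetric])
  have "cond_mutual_info M Z D P
      = (\<Sum>m\<in>M. \<Sum>z\<in>Z. \<Sum>d\<in>D. \<rho> d * (\<nu> m * (w d m z * info_density M \<nu> (w d) m z)) / ln 2)"
    unfolding cond_mutual_info_def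
  proof (intro sum.cong refl)
    fix m z d assume A: "m \<in> M" "z \<in> Z" "d \<in> D"
    have "\<rho> d \<noteq> 0" using \<rho>[OF A(3)] by simp
    then show "(if P m z d = 0 then 0 else P m z d * log 2 (P m z d * (\<Sum>a'\<in>M. \<Sum>b'\<in>Z. P a' b' d)
          / ((\<Sum>b'\<in>Z. P m b' d) * (\<Sum>a'\<in>M. P a' z d))))
        = \<rho> d * (\<nu> m * (w d m z * info_density M \<nu> (w d) m z)) / ln 2"
      by (simp only: sum_MZ sum_Z sum_M A) (simp add: P A info_density_def log_def)
  qed
  also have "\<dots> = (\<Sum>m\<in>M. \<Sum>d\<in>D. \<Sum>z\<in>Z. \<rho> d * (\<nu> m * (w d m z * info_density M \<nu> (w d) m z)) / ln 2)"
    by (intro sum.cong refl sum.swap)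
  also have "\<dots> = (\<Sum>d\<in>D. \<Sum>m\<in>M. \<Sum>z\<in>Z. \<rho> d * (\<nu> m * (w d m z * info_density M \<nu> (w d) m z)) / ln 2)"
    by (rule sum.swap)
  also have "\<dots> = (\<Sum>d\<in>D. \<rho> d * mi_nats M Z \<nu> (w d)) / ln 2"
    by (simp add: mi_nats_eq_mean_info_density joint_mean_def mean_def sum_distrib_left
        sum_divide_distrib)
  finally show ?thesis .
qed

lemma mi_nats_output_prob_le:
  assumes \<nu>: "prob_on M \<nu>" and \<mu>: "prob_on K \<mu>" and T: "\<And>C. C \<in> K \<Longrightarrow> kernel_on M Z (T C)"
    and q: "prob_on Z q" and ac: "\<And>C m. C \<in> K \<Longrightarrow> m \<in> M \<Longrightarrow> abs_cont_on Z (T C m) q"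
  shows "mi_nats M Z \<nu> (\<lambda>m. output_prob K \<mu> (\<lambda>C. T C m))
       \<le> mean K \<mu> (\<lambda>C. mean M \<nu> (\<lambda>m. rel_entropy Z (T C m) q))"
proof -
  let ?w = "\<lambda>m. output_prob K \<mu> (\<lambda>C. T C m)"
  have kernel: "kernel_on K Z (\<lambda>C. T C m)" if "m \<in> M" for m
    using T that by (simp add: kernel_on_def)
  then have w: "kernel_on M Z ?w"
    unfolding kernel_on_def[of M] using \<mu> prob_on_finite[OF q] by (auto intro: prob_on_output_prob)
  have "abs_cont_on Z (?w m) q" if "m \<in> M" for m
    using ac[OF _ that] by (auto simp: abs_cont_on_def output_prob_def mean_def)
  then have "mi_nats M Z \<nu> ?w \<le> mean M \<nu> (\<lambda>m. rel_entropy Z (?w m) q)"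
    by (intro mi_nats_le_mean_rel_entropy \<nu> w q)
  also have "\<dots> \<le> mean M \<nu> (\<lambda>m. mean K \<mu> (\<lambda>C. rel_entropy Z (T C m) q))"
    using \<mu> kernel q ac prob_on_nonneg[OF \<nu>] by (intro mean_mono rel_entropy_output_prob_le) auto
  also have "\<dots> = mean K \<mu> (\<lambda>C. mean M \<nu> (\<lambda>m. rel_entropy Z (T C m) q))"
    by (rule mean_swap)
  finally show ?thesis .
qed

lemma cond_mutual_info_le_rel_entropy:
  fixes T :: "'k \<Rightarrow> 'm \<Rightarrow> 'z \<Rightarrow> real" and r :: "'k \<Rightarrow> 'd"
  assumes \<nu>: "prob_on M \<nu>" and \<mu>: "prob_on K \<mu>" "\<And>C. C \<in> K \<Longrightarrow> 0 < \<mu> C"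
    and T: "\<And>C. C \<in> K \<Longrightarrow> kernel_on M Z (T C)"
    and q: "prob_on Z q" and ac: "\<And>C m. C \<in> K \<Longrightarrow> m \<in> M \<Longrightarrow> abs_cont_on Z (T C m) q"
    and P: "\<And>m z d. m \<in> M \<Longrightarrow> z \<in> Z \<Longrightarrow> d \<in> r ` K \<Longrightarrow>
              P m z d = (\<Sum>C\<in>{C\<in>K. r C = d}. \<mu> C * (\<nu> m * T C m z))"
  shows "cond_mutual_info M Z (r ` K) P
       \<le> mean K \<mu> (\<lambda>C. mean M \<nu> (\<lambda>m. rel_entropy Z (T C m) q)) / ln 2"
proof -
  define F where "F d = {C\<in>K. r C = d}" for d
  define \<rho> where "\<rho> d = sum \<mu> (F d)" for d
  define \<mu>' where "\<mu>' d C = \<mu> C / \<rho> d" for d C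
  define w where "w d m = output_prob (F d) (\<mu>' d) (\<lambda>C. T C m)" for d m
  have finK: "finite K" using \<mu>(1) by (rule prob_on_finite)
  have \<rho>: "0 < \<rho> d" if "d \<in> r ` K" for d
    unfolding \<rho>_def using that finK \<mu>(2) by (intro sum_pos) (auto simp: F_def)
  have \<mu>': "prob_on (F d) (\<mu>' d)" if "d \<in> r ` K" for d
    using \<rho>[OF that] \<mu>(2) finK
    by (auto simp: prob_on_def \<mu>'_def F_def \<rho>_def sum_divide_distrib[symmetric] less_imp_le)
  have T_F: "kernel_on M Z (T C)" if "C \<in> F d" for C d using T that by (simp add: F_def)
  have w: "kernel_on M Z (w d)" if "d \<in> r ` K" for d
    unfolding kernel_on_def[of M] w_def using \<mu>'[OF that] T_F prob_on_finite[OF q]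
    by (auto intro!: prob_on_output_prob simp: kernel_on_def)
  have P_w: "P m z d = \<rho> d * (\<nu> m * w d m z)" if "m \<in> M" "z \<in> Z" "d \<in> r ` K" for m z d
    using \<rho>[OF that(3)] unfolding P[OF that] w_def output_prob_def mean_def F_def[symmetric]
    by (simp add: \<mu>'_def sum_distrib_left mult_ac)
  have mi_le: "\<rho> d * mi_nats M Z \<nu> (w d)
      \<le> \<rho> d * mean (F d) (\<mu>' d) (\<lambda>C. mean M \<nu> (\<lambda>m. rel_entropy Z (T C m) q))" if "d \<in> r ` K" for d
    unfolding w_def using \<rho>[OF that] \<mu>'[OF that] T_F ac
    by (intro mult_left_mono mi_nats_output_prob_le \<nu> q) (auto simp: F_def)
  have "(\<Sum>d\<in>r ` K. \<rho> d * mi_nats M Z \<nu> (w d))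
      \<le> (\<Sum>d\<in>r ` K. \<Sum>C\<in>F d. \<mu> C * mean M \<nu> (\<lambda>m. rel_entropy Z (T C m) q))"
  proof (rule sum_mono)
    fix d assume d: "d \<in> r ` K"
    then show "\<rho> d * mi_nats M Z \<nu> (w d)
        \<le> (\<Sum>C\<in>F d. \<mu> C * mean M \<nu> (\<lambda>m. rel_entropy Z (T C m) q))"
      using mi_le[OF d] \<rho>[OF d] by (simp add: mean_def[of "F d"] \<mu>'_def sum_distrib_left)
  qed
  also have "\<dots> = mean K \<mu> (\<lambda>C. mean M \<nu> (\<lambda>m. rel_entropy Z (T C m) q))"
    unfolding F_def mean_def[of K] using finK by (intro sum.group) auto
  finally show ?thesis
    by (subst cond_mutual_info_eq_mi_nats[OF \<nu>, of "r ` K" Z w \<rho>])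
      (auto intro: w \<rho> P_w divide_right_mono)
qed

section \<open>Soft covering\<close>

lemma mean_codebook_mult_mean:
  fixes g h :: "'a \<Rightarrow> real"
  assumes p: "prob_on A p" and J: "finite J" and S: "S \<subseteq> J" and j: "j \<in> S"
  shows "mean (J \<rightarrow>\<^sub>E A) (prod_prob J (\<lambda>_. p)) (\<lambda>C. h (C j) * mean S (unif S) (\<lambda>i. g (C i)))
       = mean A p (\<lambda>u. h u * ((g u + (real (card S) - 1) * mean A p g) / real (card S)))"
proof -
  let ?M = "mean (J \<rightarrow>\<^sub>E A) (prod_prob J (\<lambda>_. p))" and ?n = "real (card S)"
  define q where "q = mean A p g"
  have finS: "finite S" using S J by (rule finite_subset)
  have diagonal: "?M (\<lambda>C. h (C j) * g (C j)) = mean A p (\<lambda>u. h u * g u)"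
    using mean_prod_prob_coordinate[of J "\<lambda>_. A" "\<lambda>_. p" j "\<lambda>u. h u * g u"] J p S j by blast
  have off_diagonal: "?M (\<lambda>C. h (C j) * g (C i)) = mean A p (\<lambda>u. h u * q)"
    if "i \<in> S - {j}" for i
    using mean_prod_prob_coordinates[of J "\<lambda>_. A" "\<lambda>_. p" j i "\<lambda>a b. h a * g b"] J p S j that
    by (auto simp: mean_cmult q_def)
  have "?M (\<lambda>C. h (C j) * mean S (unif S) (\<lambda>i. g (C i))) = (\<Sum>i\<in>S. ?M (\<lambda>C. h (C j) * g (C i))) / ?n"
    by (simp add: mean_def[of S] unif_def sum_distrib_left mean_sum[symmetric]
        mean_divide[symmetric] sum_divide_distrib)
  also have "(\<Sum>i\<in>S. ?M (\<lambda>C. h (C j) * g (C i)))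
      = mean A p (\<lambda>u. h u * g u) + real (card (S - {j})) * mean A p (\<lambda>u. h u * q)"
    using off_diagonal by (simp add: sum.remove[OF finS j] diagonal)
  also have "real (card (S - {j})) = ?n - 1"
    using card_gt_0_iff[of S] j finS by (auto simp: of_nat_diff)
  also have "(mean A p (\<lambda>u. h u * g u) + (?n - 1) * mean A p (\<lambda>u. h u * q)) / ?n
      = mean A p (\<lambda>u. h u * ((g u + (?n - 1) * q) / ?n))"
    by (simp add: mean_add[symmetric] mean_cmult[symmetric] mean_divide[symmetric] algebra_simps)
  finally show ?thesis unfolding q_def .
qed

lemma mean_codebook_ratio_le:
  assumes p: "prob_on A p" and g: "\<And>u. u \<in> A \<Longrightarrow> 0 \<le> g u" and q: "0 < mean A p g"
    and J: "finite J" and S: "S \<subseteq> J" and j: "j \<in> S"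
  shows "mean (J \<rightarrow>\<^sub>E A) (prod_prob J (\<lambda>_. p))
           (\<lambda>C. g (C j) * (mean S (unif S) (\<lambda>i. g (C i)) / mean A p g
                            / (1 + g (C j) / (real (card S) * mean A p g))))
       \<le> mean A p g"
proof -
  let ?q = "mean A p g" and ?n = "real (card S)"
  define h where "h u = g u / (?q * (1 + g u / (?n * ?q)))" for u
  have n: "0 < ?n" using j finite_subset[OF S J] by (auto simp: card_gt_0_iff)
  have "mean (J \<rightarrow>\<^sub>E A) (prod_prob J (\<lambda>_. p))
          (\<lambda>C. g (C j) * (mean S (unif S) (\<lambda>i. g (C i)) / ?q / (1 + g (C j) / (?n * ?q))))
      = mean A p (\<lambda>u. h u * ((g u + (?n - 1) * ?q) / ?n))"
    unfolding mean_codebook_mult_mean[OF p J S j, symmetric] by (simp add: h_def mult_ac)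
  also have "\<dots> \<le> mean A p g"
  proof (rule mean_mono)
    fix u assume "u \<in> A"
    define \<xi> where "\<xi> = 1 + g u / (?n * ?q)"
    have \<xi>: "0 < \<xi>" using g[OF \<open>u \<in> A\<close>] n q by (simp add: \<xi>_def add_pos_nonneg)
    have "h u * ((g u + (?n - 1) * ?q) / ?n) = g u / \<xi> * ((g u + (?n - 1) * ?q) / (?n * ?q))"
      by (simp add: h_def \<xi>_def)
    also have "(g u + (?n - 1) * ?q) / (?n * ?q) = \<xi> - 1 / ?n"
      using n q by (simp add: \<xi>_def field_simps)
    also have "g u / \<xi> * (\<xi> - 1 / ?n) \<le> g u / \<xi> * \<xi>"
      using g[OF \<open>u \<in> A\<close>] \<xi> n by (intro mult_left_mono) auto
    finally show "h u * ((g u + (?n - 1) * ?q) / ?n) \<le> g u" using \<xi> by simp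
  qed (use p in \<open>rule prob_on_nonneg\<close>)
  finally show ?thesis .
qed

lemma mean_codebook_mult_ln_le:
  assumes p: "prob_on A p" and g: "\<And>u. u \<in> A \<Longrightarrow> 0 \<le> g u" and q: "0 < mean A p g"
    and J: "finite J" and S: "S \<subseteq> J" and j: "j \<in> S"
  shows "mean (J \<rightarrow>\<^sub>E A) (prod_prob J (\<lambda>_. p))
           (\<lambda>C. g (C j) * ln (mean S (unif S) (\<lambda>i. g (C i)) / mean A p g))
       \<le> mean A p (\<lambda>u. g u * ln (1 + g u / (real (card S) * mean A p g)))"
proof -
  let ?K = "J \<rightarrow>\<^sub>E A" and ?\<mu> = "prod_prob J (\<lambda>_. p)"
  let ?X = "\<lambda>C. mean S (unif S) (\<lambda>i. g (C i)) / mean A p g"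
    and ?\<xi> = "\<lambda>u. 1 + g u / (real (card S) * mean A p g)"
  have finS: "finite S" using S J by (rule finite_subset)
  have n: "0 < real (card S)" using j finS by (auto simp: card_gt_0_iff)
  have g_codeword: "0 \<le> g (C i)" if "C \<in> ?K" "i \<in> S" for C i
    using that S g by (auto simp: PiE_def Pi_def)
  have coordinate: "mean ?K ?\<mu> (\<lambda>C. h (C j)) = mean A p h" for h
    using mean_prod_prob_coordinate[of J "\<lambda>_. A" "\<lambda>_. p" j h] J p S j by blast
  have "mean ?K (\<lambda>C. ?\<mu> C * g (C j)) (\<lambda>C. ln (?X C))
      \<le> mean ?K (\<lambda>C. ?\<mu> C * g (C j)) (\<lambda>C. ln (?\<xi> (C j)))"
  proof (rule mean_ln_le_mean_ln)
    show "mean ?K (\<lambda>C. ?\<mu> C * g (C j)) (\<lambda>C. ?X C / ?\<xi> (C j)) \<le> (\<Sum>C\<in>?K. ?\<mu> C * g (C j))"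
      using mean_codebook_ratio_le[OF assms] coordinate[of g]
      by (simp add: mean_mult_weight mean_def[of ?K])
  next
    fix C assume C: "C \<in> ?K"
    have "prob_on ?K ?\<mu>" using J p by (intro prob_on_prod_prob) auto
    then show "0 \<le> ?\<mu> C * g (C j)" using C g_codeword[OF C j] by (simp add: prob_on_nonneg)
    assume "0 < ?\<mu> C * g (C j)"
    then have gj: "0 < g (C j)" using g_codeword[OF C j] by (auto simp: order_less_le)
    also have "g (C j) \<le> (\<Sum>i\<in>S. g (C i))"
      using finS j g_codeword[OF C] by (intro member_le_sum) auto
    finally show "0 < ?X C"
      using q n by (simp add: mean_def[of S] unif_def sum_divide_distrib[symmetric])
    show "0 < ?\<xi> (C j)" using gj q by (simp add: add_pos_nonneg)
  qed
  then show ?thesis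
    unfolding mean_mult_weight coordinate[of "\<lambda>u. g u * ln (?\<xi> u)"] .
qed

lemma mean_codebook_mean_ln_le:
  assumes p: "prob_on A p" and g: "\<And>u. u \<in> A \<Longrightarrow> 0 \<le> g u"
    and J: "finite J" and S: "S \<subseteq> J" "S \<noteq> {}"
  shows "mean (J \<rightarrow>\<^sub>E A) (prod_prob J (\<lambda>_. p))
           (\<lambda>C. mean S (unif S) (\<lambda>j. g (C j)) * ln (mean S (unif S) (\<lambda>j. g (C j)) / mean A p g))
       \<le> mean A p (\<lambda>u. g u * ln (1 + g u / (real (card S) * mean A p g)))"
    (is "_ \<le> ?R")
proof (cases "mean A p g = 0")
  case True
  then show ?thesis by simp
next
  case False
  let ?M = "mean (J \<rightarrow>\<^sub>E A) (prod_prob J (\<lambda>_. p))" and ?q = "mean A p g"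
  let ?X = "\<lambda>C. mean S (unif S) (\<lambda>j. g (C j))"
  have "0 \<le> ?q" using g by (intro mean_nonneg prob_on_nonneg[OF p])
  with False have q: "0 < ?q" by simp
  have unif: "prob_on S (unif S)"
    using finite_subset[OF S(1) J] S(2) by (rule prob_on_unif)
  have "?M (\<lambda>C. ?X C * ln (?X C / ?q)) = ?M (\<lambda>C. mean S (unif S) (\<lambda>j. g (C j) * ln (?X C / ?q)))"
    by (simp add: mean_def sum_distrib_right mult.assoc)
  also have "\<dots> = mean S (unif S) (\<lambda>j. ?M (\<lambda>C. g (C j) * ln (?X C / ?q)))"
    by (rule mean_swap)
  also have "\<dots> \<le> mean S (unif S) (\<lambda>_. ?R)"
    using q g J S by (intro mean_mono mean_codebook_mult_ln_le p prob_on_nonneg[OF unif])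
  also have "\<dots> = ?R" using unif by (rule mean_const)
  finally show ?thesis .
qed

lemma soft_covering:
  assumes p: "prob_on A p" and v: "kernel_on A Z v"
    and J: "finite J" and S: "S \<subseteq> J" "S \<noteq> {}"
  shows "mean (J \<rightarrow>\<^sub>E A) (prod_prob J (\<lambda>_. p))
           (\<lambda>C. rel_entropy Z (output_prob S (unif S) (\<lambda>j. v (C j))) (output_prob A p v))
       \<le> joint_mean A Z p v (\<lambda>u z. ln (1 + v u z / (real (card S) * output_prob A p v z)))"
proof -
  let ?M = "mean (J \<rightarrow>\<^sub>E A) (prod_prob J (\<lambda>_. p))"
  let ?T = "\<lambda>C. output_prob S (unif S) (\<lambda>j. v (C j))" and ?q = "output_prob A p v"
  let ?R = "\<lambda>u z. ln (1 + v u z / (real (card S) * ?q z))"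
  have "?M (\<lambda>C. rel_entropy Z (?T C) ?q) = (\<Sum>z\<in>Z. ?M (\<lambda>C. ?T C z * ln (?T C z / ?q z)))"
    unfolding rel_entropy_def mean_def[of Z] by (rule mean_sum)
  also have "\<dots> \<le> (\<Sum>z\<in>Z. mean A p (\<lambda>u. v u z * ?R u z))"
    unfolding output_prob_def using v
    by (intro sum_mono mean_codebook_mean_ln_le p J S) (rule kernel_on_nonneg)
  also have "\<dots> = joint_mean A Z p v ?R"
    unfolding joint_mean_def mean_def[of Z] by (rule mean_sum[symmetric])
  finally show ?thesis .
qed

section \<open>Exponential moments\<close>

definition info_moment :: "'a set \<Rightarrow> 'b set \<Rightarrow> ('a \<Rightarrow> real) \<Rightarrow> ('a \<Rightarrow> 'b \<Rightarrow> real) \<Rightarrow> real \<Rightarrow> real" where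
  "info_moment A B p w \<rho> = joint_mean A B p w (\<lambda>a b. (w a b / output_prob A p w b) powr \<rho>)"

lemma ln_one_plus_le_powr:
  fixes x \<rho> :: real
  assumes "0 \<le> x" "0 < \<rho>" "\<rho> \<le> 1"
  shows "ln (1 + x) \<le> x powr \<rho> / \<rho>"
proof (cases "x = 0")
  case False
  have split: "y powr \<rho> = y * y powr (\<rho> - 1)" if "0 < y" for y :: real
    using that powr_mult_base[of y "\<rho> - 1"] by simp
  have "(1 + x) powr \<rho> = (1 + x) powr (\<rho> - 1) + x * (1 + x) powr (\<rho> - 1)"
    using split[of "1 + x"] assms by (simp add: algebra_simps)
  also have "\<dots> \<le> 1 powr (\<rho> - 1) + x * x powr (\<rho> - 1)"
    using assms False by (intro add_mono mult_left_mono powr_mono2') auto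
  also have "\<dots> = 1 + x powr \<rho>" using split[of x] assms False by simp
  finally have "ln ((1 + x) powr \<rho>) \<le> ln (1 + x powr \<rho>)" using assms by (intro ln_mono) auto
  also have "\<dots> \<le> x powr \<rho>" by (rule ln_add_one_self_le_self) simp
  finally show ?thesis using assms by (simp add: ln_powr field_simps)
qed simp

lemma soft_covering_powr:
  assumes p: "prob_on A p" and v: "kernel_on A Z v" and "finite Z"
    and J: "finite J" and S: "S \<subseteq> J" "S \<noteq> {}" and \<rho>: "0 < \<rho>" "\<rho> \<le> 1"
  shows "mean (J \<rightarrow>\<^sub>E A) (prod_prob J (\<lambda>_. p))
           (\<lambda>C. rel_entropy Z (output_prob S (unif S) (\<lambda>j. v (C j))) (output_prob A p v))
       \<le> real (card S) powr (- \<rho>) / \<rho> * info_moment A Z p v \<rho>"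
proof -
  let ?n = "real (card S)" and ?q = "output_prob A p v"
  have q: "0 \<le> ?q z" if "z \<in> Z" for z
    using prob_on_nonneg[OF prob_on_output_prob[OF p v \<open>finite Z\<close>] that] .
  have "joint_mean A Z p v (\<lambda>u z. ln (1 + v u z / (?n * ?q z)))
      \<le> joint_mean A Z p v (\<lambda>u z. ?n powr (- \<rho>) / \<rho> * (v u z / ?q z) powr \<rho>)"
  proof (rule joint_mean_mono[OF p v])
    fix u z assume uz: "u \<in> A" "z \<in> Z"
    have "ln (1 + v u z / (?n * ?q z)) \<le> (v u z / (?n * ?q z)) powr \<rho> / \<rho>"
      using kernel_on_nonneg[OF v uz] q[OF uz(2)] \<rho> by (intro ln_one_plus_le_powr) auto
    also have "(v u z / (?n * ?q z)) powr \<rho> = ?n powr (- \<rho>) * (v u z / ?q z) powr \<rho>"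
      using kernel_on_nonneg[OF v uz] q[OF uz(2)]
      by (simp add: powr_divide powr_mult powr_minus_divide)
    finally show "ln (1 + v u z / (?n * ?q z)) \<le> ?n powr (- \<rho>) / \<rho> * (v u z / ?q z) powr \<rho>"
      by simp
  qed
  also have "\<dots> = ?n powr (- \<rho>) / \<rho> * info_moment A Z p v \<rho>"
    unfolding info_moment_def by (rule joint_mean_cmult)
  finally show ?thesis using soft_covering[OF p v J S] by linarith
qed

lemma info_moment_word:
  assumes p: "\<And>i. i < N \<Longrightarrow> prob_on A (p i)" and w: "\<And>i. i < N \<Longrightarrow> kernel_on A B (w i)" and "finite B"
  shows "info_moment (seqs N A) (seqs N B) (word_prob N p) (word_kernel N w) \<rho>
       = (\<Prod>i<N. info_moment A B (p i) (w i) \<rho>)"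
proof -
  have "info_moment (seqs N A) (seqs N B) (word_prob N p) (word_kernel N w) \<rho>
      = joint_mean (seqs N A) (seqs N B) (word_prob N p) (word_kernel N w)
          (\<lambda>us ys. \<Prod>i<N. (w i (us ! i) (ys ! i) / output_prob A (p i) (w i) (ys ! i)) powr \<rho>)"
    unfolding info_moment_def output_prob_word joint_mean_def
  proof (intro mean_cong)
    fix us ys assume us: "us \<in> seqs N A" and ys: "ys \<in> seqs N B"
    have "0 \<le> w i (us ! i) (ys ! i)" if "i < N" for i
      using kernel_on_nonneg[OF w[OF that] seqs_nth[OF us that] seqs_nth[OF ys that]] .
    moreover have "0 \<le> output_prob A (p i) (w i) (ys ! i)" if "i < N" for i
      using prob_on_nonneg[OF prob_on_output_prob[OF p w \<open>finite B\<close>] seqs_nth[OF ys]] that by blast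
    ultimately show "(word_kernel N w us ys / word_prob N (\<lambda>i. output_prob A (p i) (w i)) ys) powr \<rho>
        = (\<Prod>i<N. (w i (us ! i) (ys ! i) / output_prob A (p i) (w i) (ys ! i)) powr \<rho>)"
      by (simp add: word_kernel_def word_prob_def prod_dividef[symmetric] prod_powr_distrib)
  qed
  also have "\<dots> = (\<Prod>i<N. info_moment A B (p i) (w i) \<rho>)"
    unfolding info_moment_def
    by (rule joint_mean_word[of N A B p w "\<lambda>i a b. (w i a b / output_prob A (p i) (w i) b) powr \<rho>"])
  finally show ?thesis .
qed

lemma eventually_mean_exp_le:
  assumes p: "prob_on A p" and \<delta>: "0 < \<delta>"
  shows "\<forall>\<^sub>F \<rho> in at_right 0. mean A p (\<lambda>a. exp (\<rho> * g a)) \<le> exp (\<rho> * (mean A p g + \<delta>))"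
proof -
  define M where "M \<rho> = mean A p (\<lambda>a. exp (\<rho> * g a))" for \<rho>
  have "(M has_real_derivative mean A p g) (at 0)"
    unfolding M_def mean_def by (auto intro!: derivative_eq_intros sum.cong)
  moreover have "M 0 = 1" using p by (simp add: M_def mean_const)
  ultimately have "((\<lambda>\<rho>. (M \<rho> - 1) / \<rho>) \<longlongrightarrow> mean A p g) (at 0)"
    by (simp add: DERIV_def)
  then have "((\<lambda>\<rho>. (M \<rho> - 1) / \<rho>) \<longlongrightarrow> mean A p g) (at_right 0)"
    by (rule tendsto_within_subset) simp
  then have "\<forall>\<^sub>F \<rho> in at_right 0. (M \<rho> - 1) / \<rho> < mean A p g + \<delta>"
    using \<delta> by (intro order_tendstoD) auto
  then have "\<forall>\<^sub>F \<rho> in at_right 0. M \<rho> \<le> exp (\<rho> * (mean A p g + \<delta>))"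
    using eventually_at_right_less[of "0 :: real"]
  proof eventually_elim
    case (elim \<rho>)
    then have "M \<rho> \<le> 1 + \<rho> * (mean A p g + \<delta>)" by (simp add: field_simps)
    then show ?case using exp_ge_add_one_self[of "\<rho> * (mean A p g + \<delta>)"] by linarith
  qed
  then show ?thesis unfolding M_def .
qed

lemma eventually_joint_mean_exp_le:
  assumes p: "prob_on A p" and w: "kernel_on A B w" and "finite B" and "0 < \<delta>"
  shows "\<forall>\<^sub>F \<rho> in at_right 0.
           joint_mean A B p w (\<lambda>a b. exp (\<rho> * g a b)) \<le> exp (\<rho> * (joint_mean A B p w g + \<delta>))"
  using eventually_mean_exp_le[OF prob_on_Times[OF assms(1-3)] \<open>0 < \<delta>\<close>, of "\<lambda>(a, b). g a b"]
  by (simp add: mean_Times[symmetric] split_def)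

lemma eventually_info_moment_le:
  assumes p: "prob_on A p" and w: "kernel_on A B w" and "finite B" and "0 < \<delta>"
  shows "\<forall>\<^sub>F \<rho> in at_right 0. info_moment A B p w \<rho> \<le> exp (\<rho> * (mi_nats A B p w + \<delta>))"
proof -
  have "info_moment A B p w \<rho> = joint_mean A B p w (\<lambda>a b. exp (\<rho> * info_density A p w a b))" for \<rho>
    unfolding info_moment_def joint_mean_def
  proof (intro mean_cong)
    fix a b assume ab: "a \<in> A" "p a \<noteq> 0" "b \<in> B" "w a b \<noteq> 0"
    then have "0 < output_prob A p w b"
      using prob_on_nonneg[OF p] kernel_on_nonneg[OF w]
      by (intro output_prob_pos[OF p w]) (auto simp: order_less_le)
    with ab show "(w a b / output_prob A p w b) powr \<rho> = exp (\<rho> * info_density A p w a b)"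
      by (simp add: powr_def info_density_def)
  qed
  then show ?thesis
    using eventually_joint_mean_exp_le[OF assms, of "info_density A p w"]
    by (simp add: mi_nats_eq_mean_info_density)
qed

section \<open>A universal decoding score\<close>

definition noisy :: "'b set \<Rightarrow> real \<Rightarrow> ('a \<Rightarrow> 'b \<Rightarrow> real) \<Rightarrow> 'a \<Rightarrow> 'b \<Rightarrow> real" where
  "noisy B \<eta> w = mix \<eta> w (\<lambda>_. unif B)"

lemma kernel_on_noisy:
  assumes "kernel_on A B w" "finite B" "B \<noteq> {}" "0 \<le> \<eta>" "\<eta> \<le> 1"
  shows "kernel_on A B (noisy B \<eta> w)"
  unfolding noisy_def using assms by (intro kernel_on_mix kernel_on_unif)

lemma noisy_ge:
  assumes "kernel_on A B w" "a \<in> A" "b \<in> B" "\<eta> \<le> 1"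
  shows "\<eta> / real (card B) \<le> noisy B \<eta> w a b"
  using kernel_on_nonneg[OF assms(1-3)] assms(4) by (simp add: noisy_def mix_def unif_def)

lemma mix_noisy: "mix t (noisy B \<eta> w) (noisy B \<eta> w') = noisy B \<eta> (mix t w w')"
  by (simp add: fun_eq_iff noisy_def mix_def algebra_simps)

lemma mi_nats_add_ln_le:
  assumes p: "prob_on A p" and w: "kernel_on A B w" and w': "kernel_on A B w'" and "finite B"
    and x: "0 < x" "\<And>a b. a \<in> A \<Longrightarrow> b \<in> B \<Longrightarrow> x * w a b \<le> w' a b"
  shows "mi_nats A B p w + ln x \<le> joint_mean A B p w (info_density A p w')"
proof -
  let ?q = "output_prob A p w'"
  have q: "prob_on B ?q" using p w' \<open>finite B\<close> by (rule prob_on_output_prob)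
  have q_pos: "0 < ?q b" if "a \<in> A" "b \<in> B" "0 < p a" "0 < w a b" for a b
  proof -
    have "0 < w' a b" using x(2)[OF that(1,2)] mult_pos_pos[OF x(1) that(4)] by linarith
    then show ?thesis using output_prob_pos[OF p w'] that by blast
  qed
  then have "abs_cont_on B (w a) ?q" if "a \<in> A" "0 < p a" for a
    using that kernel_on_nonneg[OF w] by (force simp: abs_cont_on_def order_less_le)
  then have "mi_nats A B p w + ln x \<le> joint_mean A B p w (\<lambda>a b. ln (w a b / ?q b)) + ln x"
    using mi_nats_le_mean_rel_entropy[OF p w q] by (simp add: joint_mean_def rel_entropy_def)
  also have "\<dots> = joint_mean A B p w (\<lambda>a b. ln (w a b / ?q b) + ln x)"
    by (simp add: joint_mean_add joint_mean_const[OF p w])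
  also have "\<dots> \<le> joint_mean A B p w (info_density A p w')"
  proof (rule joint_mean_mono[OF p w])
    fix a b assume ab: "a \<in> A" "b \<in> B" "0 < p a" "0 < w a b"
    have "ln (w a b / ?q b) + ln x = ln (x * w a b / ?q b)"
      using ab q_pos[OF ab] x(1) by (simp add: ln_mult ln_divide_pos)
    also have "\<dots> \<le> info_density A p w' a b"
      unfolding info_density_def using ab q_pos[OF ab] x
      by (intro ln_mono divide_right_mono) auto
    finally show "ln (w a b / ?q b) + ln x \<le> info_density A p w' a b" .
  qed
  finally show ?thesis .
qed

lemma mi_nats_mix_ge:
  assumes p: "prob_on A p" and w: "kernel_on A B w" and w': "kernel_on A B w'" and "finite B"
    and t: "0 < t" "t < 1"
  shows "(1 - t) * (mi_nats A B p w + ln (1 - t)) + t * (mi_nats A B p w' + ln t)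
       \<le> mi_nats A B p (mix t w w')"
proof -
  let ?v = "mix t w w'"
  have v: "kernel_on A B ?v" using w w' t by (intro kernel_on_mix) auto
  have "mi_nats A B p w + ln (1 - t) \<le> joint_mean A B p w (info_density A p ?v)"
    using t kernel_on_nonneg[OF w']
    by (intro mi_nats_add_ln_le p w v \<open>finite B\<close>) (auto simp: mix_def)
  moreover have "mi_nats A B p w' + ln t \<le> joint_mean A B p w' (info_density A p ?v)"
    using t kernel_on_nonneg[OF w]
    by (intro mi_nats_add_ln_le p w' v \<open>finite B\<close>) (auto simp: mix_def)
  ultimately show ?thesis
    unfolding mi_nats_eq_mean_info_density[of A B p ?v] joint_mean_mix
    using t by (intro add_mono mult_left_mono) auto
qed

lemma exists_noise_level:
  fixes I \<delta> :: real
  assumes "0 < \<delta>"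
  obtains \<eta> where "0 < \<eta>" "\<eta> \<le> 1 / 2" "I - \<delta> \<le> (1 - \<eta>) * (I + ln (1 - \<eta>)) + \<eta> * ln \<eta>"
proof -
  have "((\<lambda>\<eta>. (1 - \<eta>) * (I + ln (1 - \<eta>)) + \<eta> * ln \<eta>) \<longlongrightarrow> I) (at_right 0)"
    by real_asymp
  then have "\<forall>\<^sub>F \<eta> in at_right 0. I - \<delta> < (1 - \<eta>) * (I + ln (1 - \<eta>)) + \<eta> * ln \<eta>"
    using assms by (intro order_tendstoD) auto
  moreover have "\<forall>\<^sub>F \<eta> in at_right (0 :: real). \<eta> \<in> {0<..<1 / 2}"
    by (rule eventually_at_right_real) simp
  ultimately have "\<forall>\<^sub>F \<eta> in at_right 0.
      \<eta> \<in> {0<..<1 / 2} \<and> I - \<delta> < (1 - \<eta>) * (I + ln (1 - \<eta>)) + \<eta> * ln \<eta>"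
    by (rule eventually_conj[rotated])
  then show thesis
    using eventually_happens'[OF trivial_limit_at_right_real] that by fastforce
qed

lemma mi_nats_noisy_ge:
  assumes p: "prob_on A p" and w: "kernel_on A B w" and B: "finite B" "B \<noteq> {}"
    and \<eta>: "0 < \<eta>" "\<eta> < 1" and I: "I \<le> mi_nats A B p w"
  shows "(1 - \<eta>) * (I + ln (1 - \<eta>)) + \<eta> * ln \<eta> \<le> mi_nats A B p (noisy B \<eta> w)"
proof -
  have "0 \<le> mi_nats A B p (\<lambda>_. unif B)"
    using p B by (intro mi_nats_nonneg kernel_on_unif)
  then have "(1 - \<eta>) * (I + ln (1 - \<eta>)) + \<eta> * ln \<eta>
      \<le> (1 - \<eta>) * (mi_nats A B p w + ln (1 - \<eta>)) + \<eta> * (mi_nats A B p (\<lambda>_. unif B) + ln \<eta>)"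
    using I \<eta> by (intro add_mono mult_left_mono) auto
  also have "\<dots> \<le> mi_nats A B p (noisy B \<eta> w)"
    unfolding noisy_def using p w B \<eta> by (intro mi_nats_mix_ge kernel_on_unif)
  finally show ?thesis .
qed

lemma mean_mix_ratio_le:
  assumes b: "kernel_on A B b" and b': "kernel_on A B b'" and x: "x \<in> A"
    and lower: "\<And>y. y \<in> B \<Longrightarrow> m \<le> b x y" "0 < m"
  shows "mean B (mix t b b' x) (\<lambda>y. mix t b b' x y / b x y - 1) \<le> t\<^sup>2 * (real (card B) / m)"
proof -
  define d where "d y = b' x y - b x y" for y
  have mix_eq: "mix t b b' x y = b x y + t * d y" for y by (simp add: mix_def d_def algebra_simps)
  have d_sum: "sum d B = 0"
    using prob_on_sum[OF kernel_onD[OF b x]] prob_on_sum[OF kernel_onD[OF b' x]]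
    by (simp add: d_def sum_subtractf)
  have "mix t b b' x y * (mix t b b' x y / b x y - 1) \<le> t * d y + t\<^sup>2 / m" if y: "y \<in> B" for y
  proof -
    have "\<bar>d y\<bar> \<le> 1"
      using kernel_on_nonneg[OF b x y] prob_on_le_1[OF kernel_onD[OF b x] y]
        kernel_on_nonneg[OF b' x y] prob_on_le_1[OF kernel_onD[OF b' x] y] by (simp add: d_def)
    then have "(d y)\<^sup>2 / b x y \<le> 1 / m"
      using lower(1)[OF y] lower(2) by (intro frac_le) (auto simp: abs_square_le_1)
    then have "t\<^sup>2 * ((d y)\<^sup>2 / b x y) \<le> t\<^sup>2 * (1 / m)" by (intro mult_left_mono) auto
    moreover have "mix t b b' x y * (mix t b b' x y / b x y - 1)
        = t * d y + t\<^sup>2 * ((d y)\<^sup>2 / b x y)"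
      using lower(1)[OF y] lower(2) by (simp add: mix_eq field_simps power2_eq_square)
    ultimately show ?thesis by simp
  qed
  then have "mean B (mix t b b' x) (\<lambda>y. mix t b b' x y / b x y - 1) \<le> (\<Sum>y\<in>B. t * d y + t\<^sup>2 / m)"
    unfolding mean_def by (rule sum_mono)
  then show ?thesis by (simp add: sum.distrib sum_distrib_left[symmetric] d_sum mult.commute)
qed

text \<open>The information density of the base point is the gradient of mutual information there.\<close>

lemma mi_nats_mix_le:
  assumes p: "prob_on A p" and b: "kernel_on A B b" and b': "kernel_on A B b'" and "finite B"
    and lower: "\<And>x y. x \<in> A \<Longrightarrow> y \<in> B \<Longrightarrow> m \<le> b x y" "0 < m" and t: "0 \<le> t" "t \<le> 1"
  shows "mi_nats A B p (mix t b b')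
       \<le> (1 - t) * mi_nats A B p b + t * joint_mean A B p b' (info_density A p b)
          + t\<^sup>2 * (real (card B) / m)"
proof -
  define v where "v = mix t b b'"
  let ?q = "output_prob A p b"
  have v: "kernel_on A B v" unfolding v_def using b b' t by (rule kernel_on_mix)
  have q: "prob_on B ?q" using p b \<open>finite B\<close> by (rule prob_on_output_prob)
  have b_pos: "0 < b x y" if "x \<in> A" "y \<in> B" for x y
    using lower(1)[OF that] lower(2) by linarith
  have q_pos: "0 < ?q y" if "y \<in> B" for y
    using output_prob_ge[of A p m b y] p lower that by fastforce
  have "mi_nats A B p v \<le> mean A p (\<lambda>x. rel_entropy B (v x) ?q)"
    using q_pos by (intro mi_nats_le_mean_rel_entropy[OF p v q]) (force simp: abs_cont_on_def)
  also have "\<dots> = joint_mean A B p v (\<lambda>x y. ln (v x y / ?q y))"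
    by (simp add: joint_mean_def rel_entropy_def)
  also have "\<dots> \<le> joint_mean A B p v (\<lambda>x y. info_density A p b x y + (v x y / b x y - 1))"
  proof (rule joint_mean_mono[OF p v])
    fix x y assume xy: "x \<in> A" "y \<in> B" "0 < v x y"
    then have "ln (v x y / ?q y) = info_density A p b x y + ln (v x y / b x y)"
      using b_pos q_pos by (simp add: info_density_def ln_divide_pos)
    then show "ln (v x y / ?q y) \<le> info_density A p b x y + (v x y / b x y - 1)"
      using ln_le_minus_one[of "v x y / b x y"] xy b_pos by simp
  qed
  also have "\<dots> = joint_mean A B p v (info_density A p b)
      + mean A p (\<lambda>x. mean B (v x) (\<lambda>y. v x y / b x y - 1))"
    unfolding joint_mean_add by (simp add: joint_mean_def)
  also have "mean A p (\<lambda>x. mean B (v x) (\<lambda>y. v x y / b x y - 1))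
      \<le> mean A p (\<lambda>_. t\<^sup>2 * (real (card B) / m))"
    unfolding v_def using p lower
    by (intro mean_mono mean_mix_ratio_le[OF b b']) (auto intro: prob_on_nonneg)
  finally show ?thesis
    using mean_const[OF p] by (simp add: v_def joint_mean_mix mi_nats_eq_mean_info_density)
qed

lemma near_minimiser_info_density:
  fixes \<B> :: "('a \<Rightarrow> 'b \<Rightarrow> real) set"
  assumes p: "prob_on A p" and "finite B" and \<B>: "\<And>b. b \<in> \<B> \<Longrightarrow> kernel_on A B b" "\<B> \<noteq> {}"
    and lower: "\<And>b x y. b \<in> \<B> \<Longrightarrow> x \<in> A \<Longrightarrow> y \<in> B \<Longrightarrow> m \<le> b x y" "0 < m"
    and convex: "\<And>b b' t. b \<in> \<B> \<Longrightarrow> b' \<in> \<B> \<Longrightarrow> 0 \<le> t \<Longrightarrow> t \<le> 1 \<Longrightarrow> mix t b b' \<in> \<B>"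
    and I: "\<And>b. b \<in> \<B> \<Longrightarrow> I \<le> mi_nats A B p b" and \<delta>: "0 < \<delta>"
  obtains b where "b \<in> \<B>" and "\<And>b'. b' \<in> \<B> \<Longrightarrow> I - \<delta> \<le> joint_mean A B p b' (info_density A p b)"
proof -
  define J where "J = Inf (mi_nats A B p ` \<B>)"
  define K where "K = real (card B) / m + 1"
  define t where "t = min 1 (\<delta> / 2 / K)"
  have K: "0 < K" "real (card B) / m \<le> K" using lower(2) by (auto simp: K_def add_nonneg_pos)
  have t: "0 < t" "t \<le> 1" using \<delta> K by (auto simp: t_def)
  have "t * K \<le> \<delta> / 2 / K * K"
    using K by (intro mult_right_mono) (auto simp: t_def)
  then have tK: "t * K \<le> \<delta> / 2" using K by simp
  have J_le: "J \<le> mi_nats A B p b" if "b \<in> \<B>" for b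
    unfolding J_def using that I by (intro cInf_lower) (auto intro!: bdd_belowI[of _ I])
  have I_le: "I \<le> J" unfolding J_def using \<B>(2) I by (intro cInf_greatest) auto
  have "J < J + t * \<delta> / 2" using t \<delta> by simp
  then obtain b where b: "b \<in> \<B>" "mi_nats A B p b < J + t * \<delta> / 2"
    using cInf_lessD[of "mi_nats A B p ` \<B>"] \<B>(2) unfolding J_def by blast
  have "I - \<delta> \<le> joint_mean A B p b' (info_density A p b)" (is "_ \<le> ?E") if b': "b' \<in> \<B>" for b'
  proof -
    have "J \<le> mi_nats A B p (mix t b b')" using b(1) b' t by (intro J_le convex) auto
    also have "\<dots> \<le> (1 - t) * mi_nats A B p b + t * ?E + t\<^sup>2 * (real (card B) / m)"
      using t \<open>finite B\<close> lower b(1) b' by (intro mi_nats_mix_le p \<B>(1)) auto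
    also have "t\<^sup>2 * (real (card B) / m) \<le> t\<^sup>2 * K" using K by (intro mult_left_mono) auto
    also have "(1 - t) * mi_nats A B p b \<le> (1 - t) * (J + t * \<delta> / 2)"
      using b(2) t by (intro mult_left_mono) auto
    also have "\<dots> \<le> (1 - t) * J + t * \<delta> / 2"
      using t \<delta> by (simp add: ring_distribs)
    finally have "t * J \<le> t * (?E + \<delta> / 2 + t * K)"
      by (simp add: algebra_simps power2_eq_square)
    then have "J \<le> ?E + \<delta> / 2 + t * K" using t(1) by simp
    then show ?thesis using tK I_le by linarith
  qed
  then show thesis using that b(1) by blast
qed

definition normalised_score :: "'a set \<Rightarrow> 'b set \<Rightarrow> ('a \<Rightarrow> real) \<Rightarrow> ('a \<Rightarrow> 'b \<Rightarrow> real) \<Rightarrow> bool" where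
  "normalised_score A B p \<theta> \<longleftrightarrow> (\<forall>b\<in>B. mean A p (\<lambda>a. exp (\<theta> a b)) \<le> 1)"

lemma mean_exp_info_density:
  assumes "prob_on A p" and "\<And>a. a \<in> A \<Longrightarrow> 0 < w a b" and "0 < output_prob A p w b"
  shows "mean A p (\<lambda>a. exp (info_density A p w a b)) = 1"
proof -
  have "mean A p (\<lambda>a. exp (info_density A p w a b)) = mean A p (\<lambda>a. w a b / output_prob A p w b)"
    using assms by (intro mean_cong) (simp add: info_density_def)
  then show ?thesis using assms(3) by (simp add: mean_divide output_prob_def)
qed

lemma joint_mean_noisy_le:
  assumes p: "prob_on A p" and "0 \<le> \<eta>"
    and \<theta>: "normalised_score A B p \<theta>"
  shows "joint_mean A B p (noisy B \<eta> w) \<theta> \<le> (1 - \<eta>) * joint_mean A B p w \<theta>"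
proof -
  have "mean A p (\<lambda>a. \<theta> a b) \<le> 0" if "b \<in> B" for b
  proof -
    have "mean A p (\<lambda>a. \<theta> a b) \<le> mean A p (\<lambda>a. exp (\<theta> a b) - 1)"
    proof (rule mean_mono)
      show "\<theta> a b \<le> exp (\<theta> a b) - 1" for a using exp_ge_add_one_self[of "\<theta> a b"] by linarith
    qed (use p in \<open>rule prob_on_nonneg\<close>)
    also have "\<dots> \<le> 0"
      using \<theta> that mean_const[OF p] by (simp add: mean_diff normalised_score_def)
    finally show ?thesis .
  qed
  then have "mean B (unif B) (\<lambda>b. mean A p (\<lambda>a. \<theta> a b)) \<le> mean B (unif B) (\<lambda>_. 0)"
    by (intro mean_mono) (auto simp: unif_def)
  then have "joint_mean A B p (\<lambda>_. unif B) \<theta> \<le> 0"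
    unfolding joint_mean_def by (simp add: mean_swap[of A])
  then have "\<eta> * joint_mean A B p (\<lambda>_. unif B) \<theta> \<le> 0"
    using \<open>0 \<le> \<eta>\<close> by (simp add: mult_nonneg_nonpos)
  then show ?thesis by (simp add: noisy_def joint_mean_mix)
qed

text \<open>An approximate minimiser replaces a compactness argument, and mixing the channels with uniform
  noise keeps the information density finite.\<close>

lemma universal_score_exists:
  fixes \<W> :: "('a \<Rightarrow> 'b \<Rightarrow> real) set"
  assumes p: "prob_on A p" and B: "finite B" "B \<noteq> {}" and \<W>: "\<And>w. w \<in> \<W> \<Longrightarrow> kernel_on A B w" "\<W> \<noteq> {}"
    and convex: "\<And>w w' t. w \<in> \<W> \<Longrightarrow> w' \<in> \<W> \<Longrightarrow> 0 \<le> t \<Longrightarrow> t \<le> 1 \<Longrightarrow> mix t w w' \<in> \<W>"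
    and I: "0 \<le> I" "\<And>w. w \<in> \<W> \<Longrightarrow> I \<le> mi_nats A B p w" and \<delta>: "0 < \<delta>"
  obtains \<theta> where "normalised_score A B p \<theta>"
    and "\<And>w. w \<in> \<W> \<Longrightarrow> I - \<delta> \<le> joint_mean A B p w \<theta>"
proof -
  obtain \<eta> where \<eta>: "0 < \<eta>" "\<eta> \<le> 1 / 2"
    and level: "I - \<delta> / 4 \<le> (1 - \<eta>) * (I + ln (1 - \<eta>)) + \<eta> * ln \<eta>"
    using exists_noise_level[of "\<delta> / 4" I] \<delta> by auto
  define m where "m = \<eta> / real (card B)"
  have m: "0 < m" using \<eta> B by (simp add: m_def card_gt_0_iff)
  let ?\<B> = "noisy B \<eta> ` \<W>"
  have kernel: "kernel_on A B b" if "b \<in> ?\<B>" for b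
    using that \<W>(1) B \<eta> by (auto intro!: kernel_on_noisy)
  have lower: "m \<le> b x y" if "b \<in> ?\<B>" "x \<in> A" "y \<in> B" for b x y
    using that noisy_ge[OF \<W>(1)] \<eta> by (auto simp: m_def)
  have mi_noisy: "I - \<delta> / 4 \<le> mi_nats A B p b" if "b \<in> ?\<B>" for b
    using that level mi_nats_noisy_ge[OF p \<W>(1) B \<eta>(1) _ I(2)] \<eta>(2) by fastforce
  obtain b where b: "b \<in> ?\<B>"
    and score: "\<And>b'. b' \<in> ?\<B> \<Longrightarrow> I - \<delta> / 4 - \<delta> / 4 \<le> joint_mean A B p b' (info_density A p b)"
    by (rule near_minimiser_info_density[of A p B ?\<B> m "I - \<delta> / 4" "\<delta> / 4"])
      (use p B(1) kernel \<W>(2) lower m mi_noisy \<delta> in \<open>auto simp: mix_noisy convex\<close>)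
  let ?\<theta> = "info_density A p b"
  have normalised: "normalised_score A B p ?\<theta>"
    unfolding normalised_score_def
  proof
    fix y assume y: "y \<in> B"
    have "0 < b x y" if "x \<in> A" for x using lower[OF b that y] m by linarith
    moreover have "0 < output_prob A p b y"
      using output_prob_ge[of A p m b y] p lower[OF b _ y] m by fastforce
    ultimately show "mean A p (\<lambda>x. exp (?\<theta> x y)) \<le> 1"
      using mean_exp_info_density[of A p b y] p by simp
  qed
  have "I - \<delta> \<le> joint_mean A B p w ?\<theta>" (is "_ \<le> ?E") if w: "w \<in> \<W>" for w
  proof (rule ccontr)
    assume E: "\<not> ?thesis"
    have "I - \<delta> / 2 \<le> joint_mean A B p (noisy B \<eta> w) ?\<theta>" using score[of "noisy B \<eta> w"] w by simp
    also have "\<dots> \<le> (1 - \<eta>) * ?E" using p \<eta> normalised by (intro joint_mean_noisy_le) auto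
    also have "\<dots> < (1 - \<eta>) * (I - \<delta>)" using E \<eta> by (intro mult_strict_left_mono) auto
    finally have "\<delta> / 2 + \<eta> * I < \<eta> * \<delta>" by (simp add: algebra_simps)
    moreover have "\<eta> * \<delta> \<le> 1 / 2 * \<delta>" using \<eta> \<delta> by (intro mult_right_mono) auto
    moreover have "0 \<le> \<eta> * I" using \<eta> I(1) by simp
    ultimately show False by linarith
  qed
  then show thesis using that normalised by blast
qed

section \<open>Threshold decoding\<close>

definition threshold_decoder ::
  "nat \<Rightarrow> nat \<Rightarrow> ('u \<Rightarrow> 'y \<Rightarrow> real) \<Rightarrow> real \<Rightarrow> (nat \<times> nat \<Rightarrow> 'u) \<Rightarrow> 'y \<Rightarrow> nat" where
  "threshold_decoder Mn L S a C y =
     (if \<exists>m<Mn. \<exists>l<L. a \<le> S (C (m, l)) y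
      then LEAST m. m < Mn \<and> (\<exists>l<L. a \<le> S (C (m, l)) y) else 0)"

lemma threshold_decoder_less: "0 < Mn \<Longrightarrow> threshold_decoder Mn L S a C y < Mn"
  unfolding threshold_decoder_def
  by (auto intro: LeastI2[where Q = "\<lambda>m. m < Mn"])

lemma threshold_decoder_eq:
  assumes "m < Mn" "l < L" "a \<le> S (C (m, l)) y"
    and "\<And>j. j \<in> ({..<Mn} - {m}) \<times> {..<L} \<Longrightarrow> S (C j) y < a"
  shows "threshold_decoder Mn L S a C y = m"
proof -
  have unique: "m' = m" if "m' < Mn" "l' < L" "a \<le> S (C (m', l')) y" for m' l'
    using assms(4)[of "(m', l')"] that by force
  then have "(LEAST m. m < Mn \<and> (\<exists>l<L. a \<le> S (C (m, l)) y)) = m"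
    using assms(1-3) by (intro Least_equality) blast+
  then show ?thesis using assms(1-3) unfolding threshold_decoder_def by auto
qed

lemma threshold_decoder_union_bound:
  assumes "m < Mn" "l < L"
  shows "of_bool (threshold_decoder Mn L S a C y \<noteq> m)
       \<le> of_bool (S (C (m, l)) y < a)
          + (\<Sum>j\<in>({..<Mn} - {m}) \<times> {..<L}. of_bool (a \<le> S (C j) y) :: real)"
    (is "_ \<le> _ + ?hits")
proof (cases "\<exists>j\<in>({..<Mn} - {m}) \<times> {..<L}. a \<le> S (C j) y")
  case True
  then obtain j where "j \<in> ({..<Mn} - {m}) \<times> {..<L}" "a \<le> S (C j) y" by blast
  then have "1 \<le> ?hits"
    using member_le_sum[of j "({..<Mn} - {m}) \<times> {..<L}" "\<lambda>j. of_bool (a \<le> S (C j) y) :: real"]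
    by simp
  then show ?thesis by (simp add: of_bool_def)
next
  case False
  then show ?thesis
    using threshold_decoder_eq[OF assms, of a S C y] by (auto simp: not_le sum_nonneg)
qed

lemma mean_threshold_decoder_error_le:
  assumes p: "prob_on U p" and w: "kernel_on U Y w" and "finite Y" and m: "m < Mn" and l: "l < L"
    and \<beta>: "\<And>y. y \<in> Y \<Longrightarrow> mean U p (\<lambda>u. of_bool (a \<le> S u y)) \<le> \<beta>"
  shows "mean (({..<Mn} \<times> {..<L}) \<rightarrow>\<^sub>E U) (prod_prob ({..<Mn} \<times> {..<L}) (\<lambda>_. p))
           (\<lambda>C. mean Y (w (C (m, l))) (\<lambda>y. of_bool (threshold_decoder Mn L S a C y \<noteq> m)))
       \<le> joint_mean U Y p w (\<lambda>u y. of_bool (S u y < a)) + real ((Mn - 1) * L) * \<beta>"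
proof -
  let ?J = "{..<Mn} \<times> {..<L}" and ?J' = "({..<Mn} - {m}) \<times> {..<L}"
  let ?M = "mean (?J \<rightarrow>\<^sub>E U) (prod_prob ?J (\<lambda>_. p))"
  let ?miss = "\<lambda>u. mean Y (w u) (\<lambda>y. of_bool (S u y < a) :: real)"
  let ?hit = "\<lambda>u u'. mean Y (w u) (\<lambda>y. of_bool (a \<le> S u' y) :: real)"
  have CU: "C (m, l) \<in> U" if "C \<in> ?J \<rightarrow>\<^sub>E U" for C using that m l by auto
  have codebook: "prob_on (?J \<rightarrow>\<^sub>E U) (prod_prob ?J (\<lambda>_. p))"
    using p by (intro prob_on_prod_prob) auto
  have "?M (\<lambda>C. mean Y (w (C (m, l))) (\<lambda>y. of_bool (threshold_decoder Mn L S a C y \<noteq> m)))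
      \<le> ?M (\<lambda>C. mean Y (w (C (m, l)))
              (\<lambda>y. of_bool (S (C (m, l)) y < a) + (\<Sum>j\<in>?J'. of_bool (a \<le> S (C j) y))))"
    using m l by (intro mean_mono threshold_decoder_union_bound)
      (auto intro: prob_on_nonneg[OF codebook] kernel_on_nonneg[OF w CU])
  also have "\<dots> = ?M (\<lambda>C. ?miss (C (m, l))) + (\<Sum>j\<in>?J'. ?M (\<lambda>C. ?hit (C (m, l)) (C j)))"
    by (simp only: mean_add mean_sum)
  also have "?M (\<lambda>C. ?miss (C (m, l))) = joint_mean U Y p w (\<lambda>u y. of_bool (S u y < a))"
    unfolding joint_mean_def
    using mean_prod_prob_coordinate[of ?J "\<lambda>_. U" "\<lambda>_. p" "(m, l)" ?miss] p m l by simp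
  also have "(\<Sum>j\<in>?J'. ?M (\<lambda>C. ?hit (C (m, l)) (C j))) \<le> (\<Sum>j\<in>?J'. \<beta>)"
  proof (rule sum_mono)
    fix j assume "j \<in> ?J'"
    then have "?M (\<lambda>C. ?hit (C (m, l)) (C j)) = mean U p (\<lambda>u. mean U p (?hit u))"
      using mean_prod_prob_coordinates[of ?J "\<lambda>_. U" "\<lambda>_. p" "(m, l)" j ?hit] p m l by auto
    also have "\<dots> = joint_mean U Y p w (\<lambda>_ y. mean U p (\<lambda>u'. of_bool (a \<le> S u' y)))"
      unfolding joint_mean_def by (intro mean_cong) (rule mean_swap)
    also have "\<dots> \<le> joint_mean U Y p w (\<lambda>_ _. \<beta>)" using \<beta> by (intro joint_mean_mono[OF p w])
    also have "\<dots> = \<beta>" by (rule joint_mean_const[OF p w])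
    finally show "?M (\<lambda>C. ?hit (C (m, l)) (C j)) \<le> \<beta>" .
  qed
  also have "(\<Sum>j\<in>?J'. \<beta>) = real ((Mn - 1) * L) * \<beta>"
    using m by (simp add: card_cartesian_product)
  finally show ?thesis by simp
qed

definition word_score :: "nat \<Rightarrow> ('u \<Rightarrow> 'y \<Rightarrow> real) \<Rightarrow> 'u list \<Rightarrow> 'y list \<Rightarrow> real" where
  "word_score N \<theta> us ys = (\<Sum>i<N. \<theta> (us ! i) (ys ! i))"

lemma word_score_upper_tail:
  assumes p: "prob_on A p" and \<theta>: "normalised_score A Y p \<theta>"
    and ys: "ys \<in> seqs N Y"
  shows "mean (seqs N A) (word_prob N (\<lambda>_. p)) (\<lambda>us. of_bool (a \<le> word_score N \<theta> us ys))
      \<le> exp (- a)"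
proof -
  have words: "prob_on (seqs N A) (word_prob N (\<lambda>_. p))"
    using p by (intro prob_on_word_prob) (auto intro: prob_on_finite)
  have "mean (seqs N A) (word_prob N (\<lambda>_. p)) (\<lambda>us. of_bool (a \<le> word_score N \<theta> us ys))
      \<le> mean (seqs N A) (word_prob N (\<lambda>_. p)) (\<lambda>us. exp (- a) * (\<Prod>i<N. exp (\<theta> (us ! i) (ys ! i))))"
  proof (rule mean_mono)
    fix us
    have "of_bool (a \<le> word_score N \<theta> us ys) \<le> exp (- a + word_score N \<theta> us ys)" by auto
    then show "of_bool (a \<le> word_score N \<theta> us ys) \<le> exp (- a) * (\<Prod>i<N. exp (\<theta> (us ! i) (ys ! i)))"
      by (simp add: word_score_def exp_add[symmetric] exp_sum[symmetric])
  qed (use words in \<open>rule prob_on_nonneg\<close>)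
  also have "\<dots> = exp (- a) * (\<Prod>i<N. mean A p (\<lambda>u. exp (\<theta> u (ys ! i))))"
    unfolding mean_cmult mean_word_prob[where f = "\<lambda>i u. exp (\<theta> u (ys ! i))"] ..
  also have "\<dots> \<le> exp (- a) * (\<Prod>i<N. 1)"
    using \<theta> seqs_nth[OF ys] prob_on_nonneg[OF p] unfolding normalised_score_def
    by (intro mult_left_mono prod_mono) (auto intro!: mean_nonneg)
  finally show ?thesis by simp
qed

lemma word_score_lower_tail:
  assumes p: "prob_on A p" and w: "\<And>i. i < N \<Longrightarrow> kernel_on A Y (w i)" and "finite Y" and \<rho>: "0 \<le> \<rho>"
    and moment: "\<And>i. i < N \<Longrightarrow> joint_mean A Y p (w i) (\<lambda>u y. exp (\<rho> * - \<theta> u y))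
                   \<le> exp (\<rho> * (\<delta> - joint_mean A Y p (w i) \<theta>))"
  shows "joint_mean (seqs N A) (seqs N Y) (word_prob N (\<lambda>_. p)) (word_kernel N w)
           (\<lambda>us ys. of_bool (word_score N \<theta> us ys < a))
       \<le> exp (\<rho> * (a - (\<Sum>i<N. joint_mean A Y p (w i) \<theta>) + real N * \<delta>))"
proof -
  let ?E = "joint_mean (seqs N A) (seqs N Y) (word_prob N (\<lambda>_. p)) (word_kernel N w)"
  have words: "prob_on (seqs N A) (word_prob N (\<lambda>_. p))"
    "kernel_on (seqs N A) (seqs N Y) (word_kernel N w)"
    using p w \<open>finite Y\<close> by (auto intro: prob_on_word_prob kernel_on_word_kernel prob_on_finite)
  have "?E (\<lambda>us ys. of_bool (word_score N \<theta> us ys < a))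
      \<le> ?E (\<lambda>us ys. exp (\<rho> * a) * (\<Prod>i<N. exp (\<rho> * - \<theta> (us ! i) (ys ! i))))"
  proof (rule joint_mean_mono[OF words])
    fix us ys
    have "of_bool (word_score N \<theta> us ys < a) \<le> exp (\<rho> * (a - word_score N \<theta> us ys))"
      using \<rho> by auto
    also have "\<dots> = exp (\<rho> * a) * (\<Prod>i<N. exp (\<rho> * - \<theta> (us ! i) (ys ! i)))"
      by (simp add: word_score_def exp_sum[symmetric] exp_add[symmetric] sum_distrib_left sum_negf
          algebra_simps)
    finally show "of_bool (word_score N \<theta> us ys < a)
        \<le> exp (\<rho> * a) * (\<Prod>i<N. exp (\<rho> * - \<theta> (us ! i) (ys ! i)))" .
  qed
  also have "\<dots> = exp (\<rho> * a) * (\<Prod>i<N. joint_mean A Y p (w i) (\<lambda>u y. exp (\<rho> * - \<theta> u y)))"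
    unfolding joint_mean_cmult joint_mean_word[where f = "\<lambda>i u y. exp (\<rho> * - \<theta> u y)"] ..
  also have "\<dots> \<le> exp (\<rho> * a) * (\<Prod>i<N. exp (\<rho> * (\<delta> - joint_mean A Y p (w i) \<theta>)))"
  proof (intro mult_left_mono prod_mono conjI moment)
    fix i assume "i \<in> {..<N}"
    then have "joint_mean A Y p (w i) (\<lambda>_ _. 0) \<le> joint_mean A Y p (w i) (\<lambda>u y. exp (\<rho> * - \<theta> u y))"
      by (intro joint_mean_mono p w) auto
    then show "0 \<le> joint_mean A Y p (w i) (\<lambda>u y. exp (\<rho> * - \<theta> u y))" by (simp add: joint_mean_def)
  qed auto
  also have "\<dots> = exp (\<rho> * (a - (\<Sum>i<N. joint_mean A Y p (w i) \<theta>) + real N * \<delta>))"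
    by (simp add: exp_sum[symmetric] exp_add[symmetric] sum_distrib_left[symmetric] sum_subtractf
        algebra_simps)
  finally show ?thesis .
qed

section \<open>Random codes from stochastic encoders\<close>

text \<open>The private randomness of the stochastic encoder \<open>e C m\<close> is absorbed into the index \<open>g\<close>,
  while the decoder reveals no more than the shared randomness \<open>C\<close> does.\<close>

definition realises_encoder ::
  "nat \<Rightarrow> nat \<Rightarrow> nat set \<Rightarrow> (nat \<Rightarrow> real) \<Rightarrow> (nat \<Rightarrow> nat \<Rightarrow> 'x::finite list) \<Rightarrow>
   (nat \<Rightarrow> 'y::finite list \<Rightarrow> nat) \<Rightarrow>
   'k set \<Rightarrow> ('k \<Rightarrow> real) \<Rightarrow> ('k \<Rightarrow> nat \<Rightarrow> 'x list \<Rightarrow> real) \<Rightarrow> ('k \<Rightarrow> 'y list \<Rightarrow> nat) \<Rightarrow> bool" where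
  "realises_encoder N Mn G \<pi> f \<phi> K \<mu> e \<psi> \<longleftrightarrow>
     random_code N Mn G \<pi> f \<phi> \<and> \<phi> ` G = \<psi> ` K \<and>
     (\<forall>m<Mn. \<forall>F. mean G \<pi> (\<lambda>g. F (\<phi> g) (f g m))
                = mean K \<mu> (\<lambda>C. mean (seqs N UNIV) (e C m) (F (\<psi> C))))"

lemma mean_nat_index:
  assumes "prob_on S \<nu>"
  obtains h and G :: "nat set" where "h ` G = S" "prob_on G (\<nu> \<circ> h)"
    and "\<And>F. mean G (\<nu> \<circ> h) (\<lambda>g. F (h g)) = mean S \<nu> F"
proof -
  obtain h where h: "bij_betw h {0..<card S} S"
    using ex_bij_betw_nat_finite[OF prob_on_finite[OF assms]] by blast
  let ?G = "{0..<card S}"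
  have image: "h ` ?G = S" using h by (rule bij_betw_imp_surj_on)
  have reindex: "(\<Sum>g\<in>?G. F (h g)) = sum F S" for F :: "_ \<Rightarrow> real"
    using h by (rule sum.reindex_bij_betw)
  have "prob_on ?G (\<nu> \<circ> h)"
    using assms image reindex[of \<nu>] by (auto simp: prob_on_def)
  moreover have "mean ?G (\<nu> \<circ> h) (\<lambda>g. F (h g)) = mean S \<nu> F" for F
    using reindex[of "\<lambda>x. \<nu> x * F x"] by (simp add: mean_def)
  ultimately show thesis using image that by blast
qed

lemma exists_realising_code:
  fixes e :: "'k \<Rightarrow> nat \<Rightarrow> 'x::finite list \<Rightarrow> real" and \<psi> :: "'k \<Rightarrow> 'y::finite list \<Rightarrow> nat"
  assumes \<mu>: "prob_on K \<mu>" and "0 < Mn" and e: "\<And>C. C \<in> K \<Longrightarrow> kernel_on {..<Mn} (seqs N UNIV) (e C)"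
    and \<psi>: "\<And>C ys. C \<in> K \<Longrightarrow> ys \<in> seqs N UNIV \<Longrightarrow> \<psi> C ys < Mn"
  obtains G \<pi> f \<phi> where "realises_encoder N Mn G \<pi> f \<phi> K \<mu> e \<psi>"
proof -
  let ?X = "seqs N (UNIV :: 'x set)"
  define T where "T = {..<Mn} \<rightarrow>\<^sub>E ?X"
  have finT: "finite T" unfolding T_def by (intro finite_PiE) (simp_all add: finite_seqs)
  have T_kernel: "kernel_on K T (\<lambda>C. prod_prob {..<Mn} (e C))"
    unfolding kernel_on_def[of K] T_def by (intro ballI prob_on_prod_prob kernel_onD[OF e]) auto
  define \<nu> where "\<nu> = (\<lambda>(C, t). \<mu> C * prod_prob {..<Mn} (e C) t)"
  have "prob_on (K \<times> T) \<nu>"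
    unfolding \<nu>_def using \<mu> T_kernel finT by (rule prob_on_Times)
  then obtain h and G :: "nat set" where hG: "h ` G = K \<times> T" and prob: "prob_on G (\<nu> \<circ> h)"
    and index: "\<And>F. mean G (\<nu> \<circ> h) (\<lambda>g. F (h g)) = mean (K \<times> T) \<nu> F"
    by (rule mean_nat_index) blast
  define f \<phi> where "f g = snd (h g)" and "\<phi> g = \<psi> (fst (h g))" for g
  have h_mem: "fst (h g) \<in> K" "snd (h g) \<in> T" if "g \<in> G" for g
    using that hG by (metis imageI mem_Times_iff)+
  have length: "length (f g m) = N" if "g \<in> G" "m < Mn" for g m
    using h_mem[OF that(1)] that by (auto simp: f_def T_def seqs_def PiE_def Pi_def)
  have "random_code N Mn G (\<nu> \<circ> h) f \<phi>"
    using \<open>0 < Mn\<close> prob length h_mem \<psi> by (simp add: random_code_def \<phi>_def prob_on_def)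
  moreover have "\<phi> ` G = \<psi> ` K"
  proof -
    have "replicate N undefined \<in> ?X" by (simp add: seqs_def)
    then have "T \<noteq> {}" unfolding T_def by (auto simp: PiE_eq_empty_iff)
    then have "fst ` h ` G = K" by (simp add: hG)
    moreover have "\<phi> ` G = \<psi> ` fst ` h ` G" by (simp add: image_image \<phi>_def)
    ultimately show ?thesis by simp
  qed
  moreover have "mean G (\<nu> \<circ> h) (\<lambda>g. F (\<phi> g) (f g m)) = mean K \<mu> (\<lambda>C. mean ?X (e C m) (F (\<psi> C)))"
    if m: "m < Mn" for m F
  proof -
    have "mean G (\<nu> \<circ> h) (\<lambda>g. F (\<phi> g) (f g m))
        = mean K \<mu> (\<lambda>C. mean T (prod_prob {..<Mn} (e C)) (\<lambda>t. F (\<psi> C) (t m)))"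
      using index[of "\<lambda>(C, t). F (\<psi> C) (t m)"] unfolding \<nu>_def mean_Times joint_mean_def
      by (simp add: \<phi>_def f_def split_def)
    also have "\<dots> = mean K \<mu> (\<lambda>C. mean ?X (e C m) (F (\<psi> C)))"
      unfolding T_def using m e
      by (intro mean_cong mean_prod_prob_coordinate) (auto intro: kernel_onD)
    finally show ?thesis .
  qed
  ultimately have "realises_encoder N Mn G (\<nu> \<circ> h) f \<phi> K \<mu> e \<psi>" by (simp add: realises_encoder_def)
  then show thesis by (rule that)
qed

lemma channel_family_iff: "channel_family W \<longleftrightarrow> (\<forall>s. kernel_on UNIV UNIV (W s))"
  by (auto simp: channel_family_def kernel_on_def prob_on_def)

lemma block_prob_eq_word_kernel:
  "length ss = N \<Longrightarrow> block_prob W ys xs ss = word_kernel N (\<lambda>i. W (ss ! i)) xs ys"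
  by (simp add: block_prob_def word_kernel_def word_prob_def)

lemma kernel_on_block:
  assumes "channel_family W"
  shows "kernel_on (seqs N UNIV) (seqs N UNIV) (word_kernel N (\<lambda>i. W (ss ! i)))"
  using assms by (intro kernel_on_word_kernel) (simp_all add: channel_family_iff)

lemma realises_encoder_imp_random_code:
  "realises_encoder N Mn G \<pi> f \<phi> K \<mu> e \<psi> \<Longrightarrow> random_code N Mn G \<pi> f \<phi>"
  by (simp add: realises_encoder_def)

lemma mean_realises_encoder:
  "realises_encoder N Mn G \<pi> f \<phi> K \<mu> e \<psi> \<Longrightarrow> m < Mn \<Longrightarrow>
   mean G \<pi> (\<lambda>g. F (\<phi> g) (f g m)) = mean K \<mu> (\<lambda>C. mean (seqs N UNIV) (e C m) (F (\<psi> C)))"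
  by (simp add: realises_encoder_def)

lemma max_err_le:
  assumes W: "channel_family W" and ss: "length ss = N"
    and code: "realises_encoder N Mn G \<pi> f \<phi> K \<mu> e \<psi>"
    and \<beta>: "\<And>m. m < Mn \<Longrightarrow> mean K \<mu> (\<lambda>C. joint_mean (seqs N UNIV) (seqs N UNIV) (e C m)
              (word_kernel N (\<lambda>i. W (ss ! i))) (\<lambda>_ ys. of_bool (\<psi> C ys \<noteq> m))) \<le> \<beta>"
  shows "max_err W N Mn G \<pi> f \<phi> ss \<le> \<beta>"
  unfolding max_err_def
proof (intro Max.boundedI)
  have rc: "random_code N Mn G \<pi> f \<phi>" using code by (rule realises_encoder_imp_random_code)
  then show "(\<lambda>m. \<Sum>g\<in>G. \<pi> g *
      (1 - (\<Sum>ys\<in>{ys\<in>seqs N UNIV. \<phi> g ys = m}. block_prob W ys (f g m) ss))) ` {..<Mn} \<noteq> {}"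
    by (auto simp: random_code_def)
  let ?w = "word_kernel N (\<lambda>i. W (ss ! i))"
  let ?err = "\<lambda>m h xs. mean (seqs N UNIV) (?w xs) (\<lambda>ys. of_bool (h ys \<noteq> m))"
  have error_prob: "1 - (\<Sum>ys\<in>{ys\<in>seqs N UNIV. h ys = m}. block_prob W ys xs ss) = ?err m h xs"
    if "xs \<in> seqs N UNIV" for m h xs
  proof -
    have w: "prob_on (seqs N UNIV) (?w xs)" using kernel_on_block[OF W] that by (rule kernel_onD)
    have "(\<Sum>ys\<in>{ys\<in>seqs N UNIV. h ys = m}. block_prob W ys xs ss)
        = mean (seqs N UNIV) (?w xs) (\<lambda>ys. of_bool (h ys = m))"
      unfolding mean_def sum.inter_filter[OF prob_on_finite[OF w]]
      by (intro sum.cong) (auto simp: block_prob_eq_word_kernel[OF ss])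
    also have "\<dots> = mean (seqs N UNIV) (?w xs) (\<lambda>ys. 1 - of_bool (h ys \<noteq> m))"
      by (intro mean_cong) simp
    finally show ?thesis using mean_const[OF w] by (simp add: mean_diff)
  qed
  fix x assume "x \<in> (\<lambda>m. \<Sum>g\<in>G. \<pi> g *
      (1 - (\<Sum>ys\<in>{ys\<in>seqs N UNIV. \<phi> g ys = m}. block_prob W ys (f g m) ss))) ` {..<Mn}"
  then obtain m where m: "m < Mn" and x: "x = (\<Sum>g\<in>G. \<pi> g *
      (1 - (\<Sum>ys\<in>{ys\<in>seqs N UNIV. \<phi> g ys = m}. block_prob W ys (f g m) ss)))" by auto
  have "f g m \<in> seqs N UNIV" if "g \<in> G" for g
    using rc m that by (simp add: random_code_def seqs_def)
  then have "x = mean G \<pi> (\<lambda>g. ?err m (\<phi> g) (f g m))"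
    unfolding x mean_def[of G] by (intro sum.cong refl) (simp add: error_prob)
  also have "\<dots> = mean K \<mu> (\<lambda>C. mean (seqs N UNIV) (e C m) (?err m (\<psi> C)))"
    using code m by (rule mean_realises_encoder)
  finally show "x \<le> \<beta>" using \<beta>[OF m] by (simp add: joint_mean_def)
qed simp

lemma secrecy_leak_le:
  fixes V :: "'s::finite \<Rightarrow> 'x::finite \<Rightarrow> 'z::finite \<Rightarrow> real" and \<psi> :: "'k \<Rightarrow> 'y::finite list \<Rightarrow> nat"
  assumes V: "channel_family V" and ss: "length ss = N"
    and code: "realises_encoder N Mn G \<pi> f \<phi> K \<mu> e \<psi>"
    and \<mu>: "prob_on K \<mu>" "\<And>C. C \<in> K \<Longrightarrow> 0 < \<mu> C"
    and e: "\<And>C. C \<in> K \<Longrightarrow> kernel_on {..<Mn} (seqs N UNIV) (e C)"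
    and T: "\<And>C m. T C m = output_prob (seqs N UNIV) (e C m) (word_kernel N (\<lambda>i. V (ss ! i)))"
    and q: "prob_on (seqs N UNIV) q" "\<And>C m. C \<in> K \<Longrightarrow> m < Mn \<Longrightarrow> abs_cont_on (seqs N UNIV) (T C m) q"
  shows "secrecy_leak V N Mn G \<pi> f \<phi> ss
       \<le> mean K \<mu> (\<lambda>C. mean {..<Mn} (unif {..<Mn})
                          (\<lambda>m. rel_entropy (seqs N UNIV) (T C m) q)) / ln 2"
proof -
  let ?Y = "seqs N (UNIV :: 'y set)" and ?X = "seqs N (UNIV :: 'x set)"
  define r where "r C = restrict (\<psi> C) ?Y" for C
  have image: "\<phi> ` G = \<psi> ` K" using code by (simp add: realises_encoder_def)
  have "0 < Mn" "finite G"
    using realises_encoder_imp_random_code[OF code] by (auto simp: random_code_def)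
  have finK: "finite K" using \<mu>(1) by (rule prob_on_finite)
  have joint: "secrecy_joint V N Mn G \<pi> f \<phi> ss m zs d
      = (\<Sum>C\<in>{C\<in>K. r C = d}. \<mu> C * (unif {..<Mn} m * T C m zs))" if m: "m < Mn" for m zs d
  proof -
    let ?F = "\<lambda>h xs. of_bool (restrict h ?Y = d) * (1 / real Mn * block_prob V zs xs ss)"
    have "secrecy_joint V N Mn G \<pi> f \<phi> ss m zs d = mean G \<pi> (\<lambda>g. ?F (\<phi> g) (f g m))"
      unfolding secrecy_joint_def mean_def using \<open>finite G\<close>
      by (subst sum.inter_filter) (auto intro!: sum.cong)
    also have "\<dots> = mean K \<mu> (\<lambda>C. mean ?X (e C m) (?F (\<psi> C)))"
      using code m by (rule mean_realises_encoder)
    also have "\<dots> = mean K \<mu> (\<lambda>C. of_bool (r C = d) * (unif {..<Mn} m * T C m zs))"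
      unfolding mean_cmult
      by (simp add: r_def T unif_def output_prob_def block_prob_eq_word_kernel[OF ss])
    also have "\<dots> = (\<Sum>C\<in>{C\<in>K. r C = d}. \<mu> C * (unif {..<Mn} m * T C m zs))"
      unfolding mean_def using finK by (subst sum.inter_filter) (auto intro!: sum.cong)
    finally show ?thesis .
  qed
  have decoders: "(\<lambda>g. restrict (\<phi> g) ?Y) ` G = r ` K"
    using arg_cong[OF image, of "image (\<lambda>h. restrict h ?Y)"] by (simp add: image_image r_def)
  have "kernel_on {..<Mn} (seqs N UNIV) (T C)" if "C \<in> K" for C
    unfolding kernel_on_def T
    using kernel_onD[OF e[OF that]] kernel_on_block[OF V]
    by (intro ballI prob_on_output_prob) (simp_all add: finite_seqs)
  then show ?thesis
    unfolding secrecy_leak_def decoders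
    using \<mu> q joint \<open>0 < Mn\<close>
    by (intro cond_mutual_info_le_rel_entropy prob_on_unif) auto
qed

section \<open>The binned codebook ensemble\<close>

definition cascade :: "('u \<Rightarrow> 'x::finite \<Rightarrow> real) \<Rightarrow> ('x \<Rightarrow> 'y \<Rightarrow> real) \<Rightarrow> 'u \<Rightarrow> 'y \<Rightarrow> real" where
  "cascade \<kappa> T u = output_prob UNIV (\<kappa> u) T"

definition codebooks :: "nat \<Rightarrow> nat \<Rightarrow> nat \<Rightarrow> 'u set \<Rightarrow> (nat \<times> nat \<Rightarrow> 'u list) set" where
  "codebooks N Mn L A = ({..<Mn} \<times> {..<L}) \<rightarrow>\<^sub>E seqs N A"

definition codebook_prob :: "nat \<Rightarrow> nat \<Rightarrow> nat \<Rightarrow> ('u \<Rightarrow> real) \<Rightarrow> (nat \<times> nat \<Rightarrow> 'u list) \<Rightarrow> real" where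
  "codebook_prob N Mn L P = prod_prob ({..<Mn} \<times> {..<L}) (\<lambda>_. word_prob N (\<lambda>_. P))"

definition bin :: "nat \<Rightarrow> nat \<Rightarrow> (nat \<times> nat) set" where
  "bin L m = {m} \<times> {..<L}"

definition bin_encoder ::
  "nat \<Rightarrow> nat \<Rightarrow> ('u \<Rightarrow> 'x \<Rightarrow> real) \<Rightarrow> (nat \<times> nat \<Rightarrow> 'u list) \<Rightarrow> nat \<Rightarrow> 'x list \<Rightarrow> real" where
  "bin_encoder N L \<kappa> C m = output_prob (bin L m) (unif (bin L m)) (\<lambda>j. word_kernel N (\<lambda>_. \<kappa>) (C j))"

lemma kernel_on_cascade:
  fixes T :: "'x::finite \<Rightarrow> 'y::finite \<Rightarrow> real"
  assumes "kernel_on A UNIV \<kappa>" "kernel_on UNIV UNIV T"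
  shows "kernel_on A UNIV (cascade \<kappa> T)"
  unfolding kernel_on_def[of A] cascade_def
  by (intro ballI prob_on_output_prob kernel_onD[OF assms(1)] assms(2) finite)

lemma prob_on_codebooks:
  assumes "prob_on A P"
  shows "prob_on (codebooks N Mn L A) (codebook_prob N Mn L P)"
  unfolding codebooks_def codebook_prob_def
  using assms by (intro prob_on_prod_prob prob_on_word_prob) (auto intro: prob_on_finite)

lemma codebook_nth: "C \<in> codebooks N Mn L A \<Longrightarrow> m < Mn \<Longrightarrow> j \<in> bin L m \<Longrightarrow> C j \<in> seqs N A"
  by (auto simp: codebooks_def bin_def)

lemma codebook_prob_pos:
  assumes "\<And>u. u \<in> A \<Longrightarrow> 0 < P u" and "C \<in> codebooks N Mn L A"
  shows "0 < codebook_prob N Mn L P C"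
  unfolding codebook_prob_def prod_prob_def
proof (rule prod_pos)
  fix j assume "j \<in> {..<Mn} \<times> {..<L}"
  then have "C j \<in> seqs N A" using assms(2) by (auto simp: codebooks_def)
  then show "0 < word_prob N (\<lambda>_. P) (C j)" using assms(1) by (intro word_prob_pos)
qed

lemma prob_on_unif_bin: "0 < L \<Longrightarrow> prob_on (bin L m) (unif (bin L m))"
  by (rule prob_on_unif) (auto simp: bin_def)

lemma kernel_on_bin_encoder:
  fixes \<kappa> :: "'u \<Rightarrow> 'x::finite \<Rightarrow> real"
  assumes \<kappa>: "kernel_on A UNIV \<kappa>" and L: "0 < L" and C: "C \<in> codebooks N Mn L A"
  shows "kernel_on {..<Mn} (seqs N UNIV) (bin_encoder N L \<kappa> C)"
  unfolding kernel_on_def[of "{..<Mn}"] bin_encoder_def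
proof (intro ballI prob_on_output_prob prob_on_unif_bin L finite_seqs finite)
  fix m assume "m \<in> {..<Mn}"
  then have "C j \<in> seqs N A" if "j \<in> bin L m" for j using codebook_nth[OF C _ that] by simp
  moreover have "kernel_on (seqs N A) (seqs N UNIV) (word_kernel N (\<lambda>_. \<kappa>))"
    using \<kappa> by (intro kernel_on_word_kernel finite)
  ultimately show "kernel_on (bin L m) (seqs N UNIV) (\<lambda>j. word_kernel N (\<lambda>_. \<kappa>) (C j))"
    by (simp add: kernel_on_def)
qed

lemma output_prob_bin_encoder:
  "output_prob (seqs N UNIV) (bin_encoder N L \<kappa> C m) (word_kernel N w)
     = output_prob (bin L m) (unif (bin L m)) (\<lambda>j. word_kernel N (\<lambda>i. cascade \<kappa> (w i)) (C j))"
  unfolding bin_encoder_def output_prob_output_prob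
  by (simp add: word_kernel_def[of N "\<lambda>_. \<kappa>"] output_prob_word)
      (simp add: word_kernel_def cascade_def)

locale wiretap_input =
  fixes W :: "'s::finite \<Rightarrow> 'x::finite \<Rightarrow> 'y::finite \<Rightarrow> real" and V :: "'s \<Rightarrow> 'x \<Rightarrow> 'z::finite \<Rightarrow> real"
    and A :: "'u set" and P :: "'u \<Rightarrow> real" and \<kappa> :: "'u \<Rightarrow> 'x \<Rightarrow> real"
  assumes W: "channel_family W" and V: "channel_family V"
    and P: "prob_on A P" and P_pos: "\<And>u. u \<in> A \<Longrightarrow> 0 < P u" and \<kappa>: "kernel_on A UNIV \<kappa>"
begin

abbreviation main :: "'s \<Rightarrow> 'u \<Rightarrow> 'y \<Rightarrow> real" where
  "main s \<equiv> cascade \<kappa> (W s)"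

abbreviation tap :: "'s \<Rightarrow> 'u \<Rightarrow> 'z \<Rightarrow> real" where
  "tap s \<equiv> cascade \<kappa> (V s)"

definition ensemble_code ::
  "nat \<Rightarrow> nat \<Rightarrow> nat \<Rightarrow> ('u \<Rightarrow> 'y \<Rightarrow> real) \<Rightarrow> real \<Rightarrow>
   nat set \<Rightarrow> (nat \<Rightarrow> real) \<Rightarrow> (nat \<Rightarrow> nat \<Rightarrow> 'x list) \<Rightarrow> (nat \<Rightarrow> 'y list \<Rightarrow> nat) \<Rightarrow> bool" where
  "ensemble_code N Mn L \<theta> a G \<pi> f \<phi> \<longleftrightarrow>
     realises_encoder N Mn G \<pi> f \<phi> (codebooks N Mn L A) (codebook_prob N Mn L P) (bin_encoder N L \<kappa>)
       (threshold_decoder Mn L (word_score N \<theta>) a)"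

definition score_moment_bound :: "('u \<Rightarrow> 'y \<Rightarrow> real) \<Rightarrow> real \<Rightarrow> real \<Rightarrow> bool" where
  "score_moment_bound \<theta> \<rho> \<delta> \<longleftrightarrow> (\<forall>s. joint_mean A UNIV P (main s) (\<lambda>u y. exp (\<rho> * - \<theta> u y))
                                  \<le> exp (\<rho> * (\<delta> - joint_mean A UNIV P (main s) \<theta>)))"

definition tap_moment_bound :: "real \<Rightarrow> real \<Rightarrow> bool" where
  "tap_moment_bound \<rho> \<delta> \<longleftrightarrow>
     (\<forall>s. info_moment A UNIV P (tap s) \<rho> \<le> exp (\<rho> * (mi_nats A UNIV P (tap s) + \<delta>)))"

lemma kernel_on_main: "kernel_on A UNIV (main s)"
  and kernel_on_tap: "kernel_on A UNIV (tap s)"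
  using W V \<kappa> by (auto intro: kernel_on_cascade simp: channel_family_iff)

lemma ensemble_code_exists:
  assumes "0 < Mn" "0 < L"
  obtains G \<pi> f \<phi> where "ensemble_code N Mn L \<theta> a G \<pi> f \<phi>"
proof (rule exists_realising_code)
  show "prob_on (codebooks N Mn L A) (codebook_prob N Mn L P)" using P by (rule prob_on_codebooks)
  show "kernel_on {..<Mn} (seqs N UNIV) (bin_encoder N L \<kappa> C)" if "C \<in> codebooks N Mn L A" for C
    using \<kappa> assms(2) that by (rule kernel_on_bin_encoder)
  show "threshold_decoder Mn L (word_score N \<theta>) a C ys < Mn" for C ys
    using assms(1) by (rule threshold_decoder_less)
qed (use assms(1) that in \<open>auto simp: ensemble_code_def\<close>)

lemma ensemble_code_max_err_le:
  assumes code: "ensemble_code N Mn L \<theta> a G \<pi> f \<phi>" and ss: "length ss = N" and "0 < L"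
    and \<rho>: "0 \<le> \<rho>"
    and \<theta>: "normalised_score A UNIV P \<theta>"
    and moment: "score_moment_bound \<theta> \<rho> \<delta>"
  shows "max_err W N Mn G \<pi> f \<phi> ss
       \<le> exp (\<rho> * (a - (\<Sum>i<N. joint_mean A UNIV P (main (ss ! i)) \<theta>) + real N * \<delta>))
         + real ((Mn - 1) * L) * exp (- a)" (is "_ \<le> ?\<beta>")
proof (rule max_err_le[OF W ss code[unfolded ensemble_code_def]])
  fix m assume m: "m < Mn"
  let ?Y = "seqs N (UNIV :: 'y set)" and ?w = "word_kernel N (\<lambda>i. main (ss ! i))"
  let ?\<psi> = "threshold_decoder Mn L (word_score N \<theta>) a"
  let ?M = "mean (codebooks N Mn L A) (codebook_prob N Mn L P)"
  let ?err = "\<lambda>C j. mean ?Y (?w (C j)) (\<lambda>ys. of_bool (?\<psi> C ys \<noteq> m) :: real)"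
  let ?miss = "joint_mean (seqs N A) ?Y (word_prob N (\<lambda>_. P)) ?w
                 (\<lambda>us ys. of_bool (word_score N \<theta> us ys < a))"
  have words: "prob_on (seqs N A) (word_prob N (\<lambda>_. P))"
    using P by (intro prob_on_word_prob) (auto intro: prob_on_finite)
  have w: "kernel_on (seqs N A) ?Y ?w" by (intro kernel_on_word_kernel kernel_on_main) simp
  have miss: "?miss \<le> exp (\<rho> * (a - (\<Sum>i<N. joint_mean A UNIV P (main (ss ! i)) \<theta>) + real N * \<delta>))"
    using P \<rho> moment unfolding score_moment_bound_def
    by (intro word_score_lower_tail kernel_on_main) simp_all
  have "joint_mean (seqs N UNIV) ?Y (bin_encoder N L \<kappa> C m) (word_kernel N (\<lambda>i. W (ss ! i)))
          (\<lambda>_ ys. of_bool (?\<psi> C ys \<noteq> m))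
      = mean (bin L m) (unif (bin L m)) (?err C)" for C
    unfolding mean_output_prob[symmetric] output_prob_bin_encoder
    unfolding mean_output_prob joint_mean_def ..
  then have "?M (\<lambda>C. joint_mean (seqs N UNIV) ?Y (bin_encoder N L \<kappa> C m)
               (word_kernel N (\<lambda>i. W (ss ! i))) (\<lambda>_ ys. of_bool (?\<psi> C ys \<noteq> m)))
      = mean (bin L m) (unif (bin L m)) (\<lambda>j. ?M (\<lambda>C. ?err C j))"
    by (simp only: mean_swap[of "codebooks N Mn L A"])
  also have "\<dots> \<le> mean (bin L m) (unif (bin L m)) (\<lambda>_. ?\<beta>)"
  proof (rule mean_mono)
    fix j assume "j \<in> bin L m"
    then obtain l where j: "j = (m, l)" and l: "l < L" by (auto simp: bin_def)
    have "?M (\<lambda>C. ?err C j) \<le> ?miss + real ((Mn - 1) * L) * exp (- a)"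
      unfolding j codebooks_def codebook_prob_def using words w m l P \<theta>
      by (intro mean_threshold_decoder_error_le word_score_upper_tail) (simp_all add: finite_seqs)
    then show "?M (\<lambda>C. ?err C j) \<le> ?\<beta>" using miss by linarith
  qed (simp add: unif_def)
  also have "\<dots> = ?\<beta>" using prob_on_unif_bin[OF \<open>0 < L\<close>] by (rule mean_const)
  finally show "?M (\<lambda>C. joint_mean (seqs N UNIV) ?Y (bin_encoder N L \<kappa> C m)
      (word_kernel N (\<lambda>i. W (ss ! i))) (\<lambda>_ ys. of_bool (?\<psi> C ys \<noteq> m))) \<le> ?\<beta>" .
qed

lemma mean_codebooks_rel_entropy_le:
  fixes N :: nat and ss :: "'s list"
  defines "v \<equiv> word_kernel N (\<lambda>i. tap (ss ! i))" and "p \<equiv> word_prob N (\<lambda>_. P)"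
  assumes m: "m < Mn" and L: "0 < L" and \<rho>: "0 < \<rho>" "\<rho> \<le> 1"
    and moment: "tap_moment_bound \<rho> \<delta>"
  shows "mean (codebooks N Mn L A) (codebook_prob N Mn L P)
           (\<lambda>C. rel_entropy (seqs N UNIV) (output_prob (bin L m) (unif (bin L m)) (\<lambda>j. v (C j)))
                  (output_prob (seqs N A) p v))
       \<le> real L powr (- \<rho>) / \<rho> * exp (\<rho> * ((\<Sum>i<N. mi_nats A UNIV P (tap (ss ! i))) + real N * \<delta>))"
    (is "?D \<le> _")
proof -
  have words: "prob_on (seqs N A) p"
    unfolding p_def using P by (intro prob_on_word_prob) (auto intro: prob_on_finite)
  have v: "kernel_on (seqs N A) (seqs N UNIV) v"
    unfolding v_def by (intro kernel_on_word_kernel kernel_on_tap finite)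
  have "?D \<le> real (card (bin L m)) powr (- \<rho>) / \<rho> * info_moment (seqs N A) (seqs N UNIV) p v \<rho>"
    unfolding codebooks_def codebook_prob_def p_def[symmetric]
    using words v m L \<rho> by (intro soft_covering_powr) (auto simp: bin_def finite_seqs)
  also have "info_moment (seqs N A) (seqs N UNIV) p v \<rho>
      = (\<Prod>i<N. info_moment A UNIV P (tap (ss ! i)) \<rho>)"
    unfolding p_def v_def using P by (intro info_moment_word kernel_on_tap finite)
  also have "\<dots> \<le> (\<Prod>i<N. exp (\<rho> * (mi_nats A UNIV P (tap (ss ! i)) + \<delta>)))"
  proof (intro prod_mono conjI)
    fix i
    show "info_moment A UNIV P (tap (ss ! i)) \<rho> \<le> exp (\<rho> * (mi_nats A UNIV P (tap (ss ! i)) + \<delta>))"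
      using moment by (simp add: tap_moment_bound_def)
    show "0 \<le> info_moment A UNIV P (tap (ss ! i)) \<rho>"
      unfolding info_moment_def joint_mean_def
      using P kernel_on_tap by (intro mean_nonneg) (auto intro: prob_on_nonneg kernel_on_nonneg)
  qed
  also have "\<dots> = exp (\<rho> * ((\<Sum>i<N. mi_nats A UNIV P (tap (ss ! i))) + real N * \<delta>))"
    by (simp add: exp_sum[symmetric] sum_distrib_left[symmetric] sum.distrib)
  finally show ?thesis
    using \<rho> by (simp add: bin_def mult_left_mono divide_right_mono)
qed

lemma ensemble_code_secrecy_leak_le:
  assumes code: "ensemble_code N Mn L \<theta> a G \<pi> f \<phi>" and ss: "length ss = N" and L: "0 < L"
    and \<rho>: "0 < \<rho>" "\<rho> \<le> 1"
    and moment: "tap_moment_bound \<rho> \<delta>"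
  shows "secrecy_leak V N Mn G \<pi> f \<phi> ss
       \<le> real L powr (- \<rho>) / \<rho>
          * exp (\<rho> * ((\<Sum>i<N. mi_nats A UNIV P (tap (ss ! i))) + real N * \<delta>)) / ln 2"
proof -
  let ?Z = "seqs N (UNIV :: 'z set)" and ?v = "word_kernel N (\<lambda>i. tap (ss ! i))"
    and ?p = "word_prob N (\<lambda>_. P)"
  let ?q = "output_prob (seqs N A) ?p ?v"
  let ?T = "\<lambda>C m. output_prob (bin L m) (unif (bin L m)) (\<lambda>j. ?v (C j))"
  let ?M = "mean (codebooks N Mn L A) (codebook_prob N Mn L P)"
  let ?\<beta> = "real L powr (- \<rho>) / \<rho>
      * exp (\<rho> * ((\<Sum>i<N. mi_nats A UNIV P (tap (ss ! i))) + real N * \<delta>))"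
  have Mn: "0 < Mn" using code by (simp add: ensemble_code_def realises_encoder_def random_code_def)
  have words: "prob_on (seqs N A) ?p"
    using P by (intro prob_on_word_prob) (auto intro: prob_on_finite)
  have words_pos: "0 < ?p us" if "us \<in> seqs N A" for us
    using P_pos that by (intro word_prob_pos)
  have v: "kernel_on (seqs N A) ?Z ?v" by (intro kernel_on_word_kernel kernel_on_tap) simp
  have ac: "abs_cont_on ?Z (?T C m) ?q" if "C \<in> codebooks N Mn L A" "m < Mn" for C m
  proof -
    have "abs_cont_on ?Z (?v (C j)) ?q" if "j \<in> bin L m" for j
      using words v codebook_nth[OF \<open>C \<in> codebooks N Mn L A\<close> \<open>m < Mn\<close> that]
      by (intro abs_cont_on_output_prob words_pos)
    then show ?thesis by (simp add: abs_cont_on_def output_prob_def[of "bin L m"] mean_def)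
  qed
  have "secrecy_leak V N Mn G \<pi> f \<phi> ss
      \<le> ?M (\<lambda>C. mean {..<Mn} (unif {..<Mn}) (\<lambda>m. rel_entropy ?Z (?T C m) ?q)) / ln 2"
    using V ss code[unfolded ensemble_code_def] prob_on_codebooks[OF P] codebook_prob_pos[OF P_pos]
      kernel_on_bin_encoder[OF \<kappa> L] output_prob_bin_encoder[symmetric]
      prob_on_output_prob[OF words v] ac
    by (intro secrecy_leak_le) (auto simp: finite_seqs)
  also have "?M (\<lambda>C. mean {..<Mn} (unif {..<Mn}) (\<lambda>m. rel_entropy ?Z (?T C m) ?q))
      = mean {..<Mn} (unif {..<Mn}) (\<lambda>m. ?M (\<lambda>C. rel_entropy ?Z (?T C m) ?q))"
    by (rule mean_swap)
  also have "\<dots> \<le> mean {..<Mn} (unif {..<Mn}) (\<lambda>_. ?\<beta>)"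
    using L \<rho> moment by (intro mean_mono mean_codebooks_rel_entropy_le) (auto simp: unif_def)
  also have "\<dots> = ?\<beta>" using Mn by (intro mean_const prob_on_unif) auto
  finally show ?thesis by (simp add: divide_right_mono)
qed

end

section \<open>Averages over the state\<close>

lemma is_pmf_iff_prob_on: "is_pmf q \<longleftrightarrow> prob_on UNIV q"
  by (simp add: is_pmf_def prob_on_def)

lemma avg_channel_eq_output_prob: "avg_channel W q x = output_prob UNIV q (\<lambda>s. W s x)"
  by (simp add: fun_eq_iff avg_channel_def output_prob_def mean_def)

lemma kernel_on_avg_channel:
  fixes W :: "'s::finite \<Rightarrow> 'x::finite \<Rightarrow> 'y::finite \<Rightarrow> real"
  assumes "channel_family W" "is_pmf q"
  shows "kernel_on UNIV UNIV (avg_channel W q)"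
  unfolding kernel_on_def avg_channel_eq_output_prob
  using assms by (intro ballI prob_on_output_prob)
    (simp_all add: is_pmf_iff_prob_on channel_family_iff kernel_on_def)

lemma cascade_avg_channel:
  "cascade \<kappa> (avg_channel W q) u = output_prob UNIV q (\<lambda>s. cascade \<kappa> (W s) u)"
  unfolding cascade_def fun_eq_iff output_prob_def avg_channel_eq_output_prob
  by (intro allI mean_swap)

lemma joint_mean_cascade_avg_channel:
  "joint_mean A B P (cascade \<kappa> (avg_channel W q)) f
      = mean UNIV q (\<lambda>s. joint_mean A B P (cascade \<kappa> (W s)) f)"
  unfolding joint_mean_def cascade_avg_channel mean_output_prob by (rule mean_swap)

lemma mix_cascade_avg_channel:
  "mix t (cascade \<kappa> (avg_channel W q)) (cascade \<kappa> (avg_channel W q'))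
     = cascade \<kappa> (avg_channel W (\<lambda>s. (1 - t) * q s + t * q' s))"
  by (simp add: fun_eq_iff mix_def cascade_avg_channel output_prob_def mean_def ring_distribs
      sum.distrib sum_distrib_left mult.assoc)

lemma pmfs_cost_convex:
  assumes "q \<in> pmfs_cost c \<Lambda>" "q' \<in> pmfs_cost c \<Lambda>" "0 \<le> t" "t \<le> 1"
  shows "(\<lambda>s. (1 - t) * q s + t * q' s) \<in> pmfs_cost c \<Lambda>"
proof -
  have "cost_pmf c (\<lambda>s. (1 - t) * q s + t * q' s) = (1 - t) * cost_pmf c q + t * cost_pmf c q'"
    by (simp add: cost_pmf_def algebra_simps sum.distrib sum_distrib_left sum_subtractf)
  also have "\<dots> \<le> (1 - t) * \<Lambda> + t * \<Lambda>"
    using assms by (intro add_mono mult_left_mono) (auto simp: pmfs_cost_def)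
  finally have "cost_pmf c (\<lambda>s. (1 - t) * q s + t * q' s) \<le> \<Lambda>" by (simp add: algebra_simps)
  moreover have "(\<Sum>s\<in>UNIV. (1 - t) * q s + t * q' s) = 1"
    using assms by (simp add: pmfs_cost_def is_pmf_def sum.distrib sum_distrib_left[symmetric])
  ultimately show ?thesis using assms by (auto simp: pmfs_cost_def is_pmf_def)
qed

lemma empirical_pmf:
  fixes ss :: "'s::finite list"
  assumes ss: "ss \<in> seqs N UNIV" and N: "0 < N" and cost: "cost_seq c ss \<le> \<Lambda>"
  obtains q where "q \<in> pmfs_cost c \<Lambda>"
    and "\<And>g :: 's \<Rightarrow> real. (\<Sum>i<N. g (ss ! i)) = real N * mean UNIV q g"
proof -
  define q where "q s = real (card {i\<in>{..<N}. ss ! i = s}) / real N" for s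
  have sum_q: "(\<Sum>i<N. g (ss ! i)) = real N * mean UNIV q g" for g :: "'s \<Rightarrow> real"
  proof -
    have "(\<Sum>i<N. g (ss ! i)) = (\<Sum>s\<in>UNIV. \<Sum>i\<in>{i\<in>{..<N}. ss ! i = s}. g (ss ! i))"
      by (rule sum.group[symmetric]) auto
    also have "\<dots> = (\<Sum>s\<in>UNIV. real N * (q s * g s))"
      using N by (intro sum.cong refl) (simp add: q_def)
    finally show ?thesis by (simp add: mean_def sum_distrib_left)
  qed
  have "is_pmf q" unfolding is_pmf_def using sum_q[of "\<lambda>_. 1"] N by (auto simp: mean_def q_def)
  moreover have "cost_pmf c q = cost_seq c ss"
    using sum_q[of c] ss N by (simp add: mean_def cost_pmf_def cost_seq_def seqs_def mult.commute)
  ultimately have "q \<in> pmfs_cost c \<Lambda>" using cost by (simp add: pmfs_cost_def)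
  then show thesis using sum_q by (rule that)
qed

section \<open>Achievability\<close>

definition secure_code ::
  "('s::finite \<Rightarrow> 'x::finite \<Rightarrow> 'y::finite \<Rightarrow> real) \<Rightarrow> ('s \<Rightarrow> 'x \<Rightarrow> 'z::finite \<Rightarrow> real) \<Rightarrow>
   ('s \<Rightarrow> real) \<Rightarrow> real \<Rightarrow> real \<Rightarrow> nat \<Rightarrow> nat \<Rightarrow> nat set \<Rightarrow> (nat \<Rightarrow> real) \<Rightarrow>
   (nat \<Rightarrow> nat \<Rightarrow> 'x list) \<Rightarrow> (nat \<Rightarrow> 'y list \<Rightarrow> nat) \<Rightarrow> bool" where
  "secure_code W V c \<Lambda> \<eta> N Mn G \<pi> f \<phi> \<longleftrightarrow> random_code N Mn G \<pi> f \<phi> \<and>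
     (\<forall>ss\<in>seqs N UNIV. cost_seq c ss \<le> \<Lambda> \<longrightarrow>
        max_err W N Mn G \<pi> f \<phi> ss \<le> \<eta> \<and> secrecy_leak V N Mn G \<pi> f \<phi> ss \<le> \<eta>)"

lemma nat_ceiling_bounds:
  fixes x :: real
  assumes "0 < x"
  shows "0 < nat \<lceil>x\<rceil>" "x \<le> real (nat \<lceil>x\<rceil>)" "real (nat \<lceil>x\<rceil>) - 1 \<le> x"
  using assms by linarith+

lemma eventually_exp_decay:
  fixes \<tau> B \<epsilon> :: real
  assumes "0 < \<tau>" "0 < \<epsilon>"
  shows "\<forall>\<^sub>F N in sequentially. B * exp (- (real N * \<tau>)) < \<epsilon>"
proof -
  have "(\<lambda>N. B * exp (- (real N * \<tau>))) \<longlonglongrightarrow> 0" using assms(1) by real_asymp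
  then show ?thesis using assms(2) by (rule order_tendstoD)
qed

lemma achievable_random_if_secure_codes:
  fixes W :: "'s::finite \<Rightarrow> 'x::finite \<Rightarrow> 'y::finite \<Rightarrow> real" and V :: "'s \<Rightarrow> 'x \<Rightarrow> 'z::finite \<Rightarrow> real"
  assumes R: "0 \<le> R" and codes: "\<And>\<delta>. 0 < \<delta> \<Longrightarrow> \<exists>\<tau>>0. \<exists>B. \<forall>N>0. \<exists>Mn G \<pi> f \<phi>.
    real N * (ln 2 * R - \<delta>) \<le> ln (real Mn) \<and>
    secure_code W V c \<Lambda> (B * exp (- (real N * \<tau>))) N Mn G \<pi> f \<phi>"
  shows "achievable_random W V c \<Lambda> R"
  unfolding achievable_random_def
proof (intro conjI R allI impI)
  fix \<epsilon> :: real assume \<epsilon>: "0 < \<epsilon>"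
  define \<delta> where "\<delta> = \<epsilon> * ln 2 / 2"
  have "0 < \<delta>" using \<epsilon> by (simp add: \<delta>_def)
  from codes[OF this] obtain \<tau> B where \<tau>: "0 < \<tau>"
    and code: "\<And>N. 0 < N \<Longrightarrow> \<exists>Mn G \<pi> f \<phi>. real N * (ln 2 * R - \<delta>) \<le> ln (real Mn) \<and>
      secure_code W V c \<Lambda> (B * exp (- (real N * \<tau>))) N Mn G \<pi> f \<phi>"
    by blast
  have "\<forall>\<^sub>F N in sequentially. 0 < N \<and> B * exp (- (real N * \<tau>)) < \<epsilon>"
    using \<tau> \<epsilon> by (intro eventually_conj eventually_exp_decay eventually_gt_at_top)
  then obtain N0 where N0: "\<And>N. N0 \<le> N \<Longrightarrow> 0 < N \<and> B * exp (- (real N * \<tau>)) < \<epsilon>"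
    unfolding eventually_sequentially by blast
  have "\<exists>Mn G \<pi> f (\<phi> :: nat \<Rightarrow> 'y list \<Rightarrow> nat). random_code N Mn G \<pi> f \<phi> \<and>
        R - \<epsilon> < log 2 (real Mn) / real N \<and>
        (\<forall>ss\<in>seqs N UNIV. cost_seq c ss \<le> \<Lambda> \<longrightarrow> max_err W N Mn G \<pi> f \<phi> ss < \<epsilon>) \<and>
        (\<forall>ss\<in>seqs N UNIV. cost_seq c ss \<le> \<Lambda> \<longrightarrow> secrecy_leak V N Mn G \<pi> f \<phi> ss < \<epsilon>)" if "N0 \<le> N" for N
  proof -
    have N: "0 < N" and decay: "B * exp (- (real N * \<tau>)) < \<epsilon>" using N0[OF that] by auto
    obtain Mn G \<pi> f and \<phi> :: "nat \<Rightarrow> 'y list \<Rightarrow> nat"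
      where rate: "real N * (ln 2 * R - \<delta>) \<le> ln (real Mn)"
        and secure: "secure_code W V c \<Lambda> (B * exp (- (real N * \<tau>))) N Mn G \<pi> f \<phi>"
      using code[OF N] by blast
    have "R - \<epsilon> < R - \<epsilon> / 2" using \<epsilon> by simp
    also have "R - \<epsilon> / 2 = real N * (ln 2 * R - \<delta>) / (ln 2 * real N)"
      using N by (simp add: \<delta>_def field_simps)
    also have "\<dots> \<le> ln (real Mn) / (ln 2 * real N)" using rate by (intro divide_right_mono) auto
    also have "\<dots> = log 2 (real Mn) / real N" by (simp add: log_def)
    finally show ?thesis
      using secure decay unfolding secure_code_def by (meson le_less_trans)
  qed
  then show "\<exists>N0. \<forall>N\<ge>N0. \<exists>Mn G \<pi> f (\<phi> :: nat \<Rightarrow> 'y list \<Rightarrow> nat). random_code N Mn G \<pi> f \<phi> \<and>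
        R - \<epsilon> < log 2 (real Mn) / real N \<and>
        (\<forall>ss\<in>seqs N UNIV. cost_seq c ss \<le> \<Lambda> \<longrightarrow> max_err W N Mn G \<pi> f \<phi> ss < \<epsilon>) \<and>
        (\<forall>ss\<in>seqs N UNIV. cost_seq c ss \<le> \<Lambda> \<longrightarrow> secrecy_leak V N Mn G \<pi> f \<phi> ss < \<epsilon>)"
    by blast
qed

lemma achievable_random_if_pmfs_cost_empty:
  fixes W :: "'s::finite \<Rightarrow> 'x::finite \<Rightarrow> 'y::finite \<Rightarrow> real" and V :: "'s \<Rightarrow> 'x \<Rightarrow> 'z::finite \<Rightarrow> real"
  assumes empty: "pmfs_cost c \<Lambda> = {}" and R: "0 \<le> R"
  shows "achievable_random W V c \<Lambda> R"
proof (rule achievable_random_if_secure_codes[OF R])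
  fix \<delta> :: real assume "0 < \<delta>"
  have "\<exists>Mn G \<pi> f \<phi>. real N * (ln 2 * R - \<delta>) \<le> ln (real Mn) \<and>
      secure_code W V c \<Lambda> (0 * exp (- (real N * 1))) N Mn G \<pi> f \<phi>" if N: "0 < N" for N
  proof -
    define Mn where "Mn = nat \<lceil>exp (real N * (ln 2 * R - \<delta>))\<rceil>"
    have Mn: "0 < Mn" "exp (real N * (ln 2 * R - \<delta>)) \<le> real Mn"
      unfolding Mn_def by (rule nat_ceiling_bounds; simp)+
    then have "real N * (ln 2 * R - \<delta>) \<le> ln (real Mn)" by (simp add: ln_ge_iff)
    moreover have "random_code N Mn {0} (\<lambda>_. 1) (\<lambda>_ _. replicate N undefined) (\<lambda>_ _. 0)"
      using Mn by (simp add: random_code_def)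
    moreover have "\<not> cost_seq c ss \<le> \<Lambda>" if "ss \<in> seqs N UNIV" for ss
      using empirical_pmf[OF that N] empty by blast
    ultimately show ?thesis unfolding secure_code_def by blast
  qed
  then show "\<exists>\<tau>>0. \<exists>B. \<forall>N>0. \<exists>Mn G \<pi> f \<phi>. real N * (ln 2 * R - \<delta>) \<le> ln (real Mn) \<and>
      secure_code W V c \<Lambda> (B * exp (- (real N * \<tau>))) N Mn G \<pi> f \<phi>"
    by (meson zero_less_one)
qed

context wiretap_input
begin

lemma eventually_score_moment_bound:
  assumes "0 < \<delta>"
  shows "\<forall>\<^sub>F \<rho> in at_right 0. score_moment_bound \<theta> \<rho> \<delta>"
proof -
  have "joint_mean A UNIV P (main s) (\<lambda>u y. - \<theta> u y) = - joint_mean A UNIV P (main s) \<theta>" for s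
    using joint_mean_cmult[of A UNIV P "main s" "- 1" \<theta>] by simp
  then show ?thesis
    unfolding score_moment_bound_def
    using eventually_joint_mean_exp_le[OF P kernel_on_main finite assms, where g = "\<lambda>u y. - \<theta> u y"]
    by (intro eventually_all_finite) simp
qed

lemma eventually_tap_moment_bound:
  assumes "0 < \<delta>"
  shows "\<forall>\<^sub>F \<rho> in at_right 0. tap_moment_bound \<rho> \<delta>"
  unfolding tap_moment_bound_def
  using P kernel_on_tap finite assms by (intro eventually_all_finite eventually_info_moment_le)

lemma exists_moment_bounds:
  assumes "0 < \<delta>"
  obtains \<rho> where "0 < \<rho>" "\<rho> \<le> 1" "score_moment_bound \<theta> \<rho> \<delta>" "tap_moment_bound \<rho> \<delta>"
proof -
  have "\<forall>\<^sub>F \<rho> in at_right (0 :: real). \<rho> \<in> {0<..<1}"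
    by (rule eventually_at_right_real) simp
  then have "\<forall>\<^sub>F \<rho> in at_right 0.
      \<rho> \<in> {0<..<1} \<and> score_moment_bound \<theta> \<rho> \<delta> \<and> tap_moment_bound \<rho> \<delta>"
    using eventually_score_moment_bound[OF assms] eventually_tap_moment_bound[OF assms]
    by (intro eventually_conj)
  then show thesis
    using eventually_happens'[OF trivial_limit_at_right_real] that by fastforce
qed

lemma exists_score:
  assumes ne: "pmfs_cost c \<Lambda> \<noteq> {}" and "0 \<le> I" and \<delta>: "0 < \<delta>"
    and I: "\<And>q. q \<in> pmfs_cost c \<Lambda> \<Longrightarrow> I \<le> mi_nats A UNIV P (cascade \<kappa> (avg_channel W q))"
  obtains \<theta> where "normalised_score A UNIV P \<theta>"
    and "\<And>q. q \<in> pmfs_cost c \<Lambda> \<Longrightarrow> I - \<delta> \<le> mean UNIV q (\<lambda>s. joint_mean A UNIV P (main s) \<theta>)"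
proof -
  let ?\<W> = "(\<lambda>q. cascade \<kappa> (avg_channel W q)) ` pmfs_cost c \<Lambda>"
  have kernel: "kernel_on A UNIV w" if "w \<in> ?\<W>" for w
    using that kernel_on_avg_channel[OF W] \<kappa> by (auto intro: kernel_on_cascade simp: pmfs_cost_def)
  have convex: "mix t w w' \<in> ?\<W>" if "w \<in> ?\<W>" "w' \<in> ?\<W>" "0 \<le> t" "t \<le> 1" for w w' t
    using that pmfs_cost_convex[of _ c \<Lambda> _ t] by (force simp: mix_cascade_avg_channel)
  have I_\<W>: "I \<le> mi_nats A UNIV P w" if "w \<in> ?\<W>" for w using I that by auto
  show thesis
  proof (rule universal_score_exists[OF P finite UNIV_not_empty kernel _ convex \<open>0 \<le> I\<close> I_\<W> \<delta>])
    show "?\<W> \<noteq> {}" using ne by simp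
  next
    fix \<theta> assume \<theta>: "normalised_score A UNIV P \<theta>"
      and mean_\<theta>: "\<And>w. w \<in> ?\<W> \<Longrightarrow> I - \<delta> \<le> joint_mean A UNIV P w \<theta>"
    show thesis
    proof (rule that[OF \<theta>])
      show "I - \<delta> \<le> mean UNIV q (\<lambda>s. joint_mean A UNIV P (main s) \<theta>)" if "q \<in> pmfs_cost c \<Lambda>" for q
        unfolding joint_mean_cascade_avg_channel[symmetric] using that by (intro mean_\<theta> imageI)
    qed
  qed
qed

lemma ensemble_code_max_err_exponential:
  assumes code: "ensemble_code N Mn L \<theta> (real N * (I - 3 * \<delta>)) G \<pi> f \<phi>" and ss: "length ss = N"
    and L: "0 < L" and \<rho>: "0 < \<rho>" "\<rho> \<le> 1" and \<delta>: "0 < \<delta>"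
    and \<theta>: "normalised_score A UNIV P \<theta>"
    and moment: "score_moment_bound \<theta> \<rho> \<delta>"
    and score: "real N * (I - \<delta>) \<le> (\<Sum>i<N. joint_mean A UNIV P (main (ss ! i)) \<theta>)"
    and size: "real ((Mn - 1) * L) \<le> 2 * exp (real N * (I - 4 * \<delta>))"
  shows "max_err W N Mn G \<pi> f \<phi> ss \<le> 3 * exp (- (real N * (\<rho> * \<delta>)))"
proof -
  let ?a = "real N * (I - 3 * \<delta>)" and ?S = "\<Sum>i<N. joint_mean A UNIV P (main (ss ! i)) \<theta>"
  have "\<rho> * (?a - ?S + real N * \<delta>) \<le> \<rho> * (- (real N * \<delta>))"
    using score \<rho> by (intro mult_left_mono) (auto simp: algebra_simps)
  then have miss: "exp (\<rho> * (?a - ?S + real N * \<delta>)) \<le> exp (- (real N * (\<rho> * \<delta>)))"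
    by (simp add: mult_ac)
  have "real ((Mn - 1) * L) * exp (- ?a) \<le> 2 * exp (real N * (I - 4 * \<delta>)) * exp (- ?a)"
    using size by (intro mult_right_mono) auto
  also have "\<dots> = 2 * exp (- (real N * \<delta>))" by (simp add: exp_add[symmetric] algebra_simps)
  also have "\<dots> \<le> 2 * exp (- (real N * (\<rho> * \<delta>)))" using \<rho> \<delta> by (simp add: mult_left_mono)
  finally have "real ((Mn - 1) * L) * exp (- ?a) \<le> 2 * exp (- (real N * (\<rho> * \<delta>)))" .
  moreover have "max_err W N Mn G \<pi> f \<phi> ss
      \<le> exp (\<rho> * (?a - ?S + real N * \<delta>)) + real ((Mn - 1) * L) * exp (- ?a)"
    using code ss L \<rho> \<theta> moment by (intro ensemble_code_max_err_le) auto
  ultimately show ?thesis using miss by linarith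
qed

lemma ensemble_code_secrecy_leak_exponential:
  assumes code: "ensemble_code N Mn L \<theta> a G \<pi> f \<phi>" and ss: "length ss = N"
    and \<rho>: "0 < \<rho>" "\<rho> \<le> 1"
    and moment: "tap_moment_bound \<rho> \<delta>"
    and mi: "(\<Sum>i<N. mi_nats A UNIV P (tap (ss ! i))) \<le> real N * J"
    and size: "exp (real N * (J + 2 * \<delta>)) \<le> real L"
  shows "secrecy_leak V N Mn G \<pi> f \<phi> ss \<le> 1 / (\<rho> * ln 2) * exp (- (real N * (\<rho> * \<delta>)))"
proof -
  let ?X = "\<Sum>i<N. mi_nats A UNIV P (tap (ss ! i))"
  have L: "0 < L" using size by (cases L) (auto simp: not_le)
  have "real L powr (- \<rho>) \<le> exp (real N * (J + 2 * \<delta>)) powr (- \<rho>)"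
    using size \<rho> by (intro powr_mono2') auto
  moreover have "exp (\<rho> * (?X + real N * \<delta>)) \<le> exp (\<rho> * (real N * J + real N * \<delta>))"
    using mi \<rho> by simp
  ultimately have "real L powr (- \<rho>) * exp (\<rho> * (?X + real N * \<delta>))
      \<le> exp (real N * (J + 2 * \<delta>)) powr (- \<rho>) * exp (\<rho> * (real N * J + real N * \<delta>))"
    by (intro mult_mono) auto
  also have "\<dots> = exp (- (real N * (\<rho> * \<delta>)))"
    by (simp add: powr_def exp_add[symmetric] algebra_simps)
  finally have "1 / (\<rho> * ln 2) * (real L powr (- \<rho>) * exp (\<rho> * (?X + real N * \<delta>)))
      \<le> 1 / (\<rho> * ln 2) * exp (- (real N * (\<rho> * \<delta>)))"
    using \<rho> by (intro mult_left_mono) auto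
  then show ?thesis
    using ensemble_code_secrecy_leak_le[OF code ss L \<rho> moment] by simp
qed

lemma ensemble_code_secure:
  assumes code: "ensemble_code N Mn L \<theta> (real N * (I - 3 * \<delta>)) G \<pi> f \<phi>" and N: "0 < N"
    and \<rho>: "0 < \<rho>" "\<rho> \<le> 1" and \<delta>: "0 < \<delta>"
    and \<theta>: "normalised_score A UNIV P \<theta>"
    and main_moment: "score_moment_bound \<theta> \<rho> \<delta>"
    and tap_moment: "tap_moment_bound \<rho> \<delta>"
    and score: "\<And>q. q \<in> pmfs_cost c \<Lambda> \<Longrightarrow> I - \<delta> \<le> mean UNIV q (\<lambda>s. joint_mean A UNIV P (main s) \<theta>)"
    and J: "\<And>q. q \<in> pmfs_cost c \<Lambda> \<Longrightarrow> mean UNIV q (\<lambda>s. mi_nats A UNIV P (tap s)) \<le> J"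
    and size: "real ((Mn - 1) * L) \<le> 2 * exp (real N * (I - 4 * \<delta>))"
      "exp (real N * (J + 2 * \<delta>)) \<le> real L"
  shows "secure_code W V c \<Lambda> ((3 + 1 / (\<rho> * ln 2)) * exp (- (real N * (\<rho> * \<delta>)))) N Mn G \<pi> f \<phi>"
  unfolding secure_code_def
proof (intro conjI ballI impI)
  show "random_code N Mn G \<pi> f \<phi>"
    using code unfolding ensemble_code_def by (rule realises_encoder_imp_random_code)
  let ?decay = "exp (- (real N * (\<rho> * \<delta>)))"
  fix ss :: "'s list" assume ss: "ss \<in> seqs N UNIV" and cost: "cost_seq c ss \<le> \<Lambda>"
  obtain q where q: "q \<in> pmfs_cost c \<Lambda>"
    and sum_q: "\<And>g :: 's \<Rightarrow> real. (\<Sum>i<N. g (ss ! i)) = real N * mean UNIV q g"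
    using empirical_pmf[OF ss N cost] by blast
  have len: "length ss = N" using ss by (simp add: seqs_def)
  have L: "0 < L" using size(2) by (cases L) (auto simp: not_le)
  have "max_err W N Mn G \<pi> f \<phi> ss \<le> 3 * ?decay"
    using score[OF q]
    by (intro ensemble_code_max_err_exponential[OF code len L \<rho> \<delta> \<theta> main_moment _ size(1)])
      (simp add: sum_q[of "\<lambda>s. joint_mean A UNIV P (main s) \<theta>"] mult_left_mono)
  also have "\<dots> \<le> (3 + 1 / (\<rho> * ln 2)) * ?decay" using \<rho> by (intro mult_right_mono) auto
  finally show "max_err W N Mn G \<pi> f \<phi> ss \<le> (3 + 1 / (\<rho> * ln 2)) * ?decay" .
  have "secrecy_leak V N Mn G \<pi> f \<phi> ss \<le> 1 / (\<rho> * ln 2) * ?decay"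
    using J[OF q]
    by (intro ensemble_code_secrecy_leak_exponential[OF code len \<rho> tap_moment _ size(2)])
      (simp add: sum_q[of "\<lambda>s. mi_nats A UNIV P (tap s)"] mult_left_mono)
  also have "\<dots> \<le> (3 + 1 / (\<rho> * ln 2)) * ?decay" by (intro mult_right_mono) auto
  finally show "secrecy_leak V N Mn G \<pi> f \<phi> ss \<le> (3 + 1 / (\<rho> * ln 2)) * ?decay" .
qed

lemma exists_secure_codes:
  assumes ne: "pmfs_cost c \<Lambda> \<noteq> {}" and nonneg: "0 \<le> I" "0 \<le> J" and \<delta>: "0 < \<delta>"
    and I: "\<And>q. q \<in> pmfs_cost c \<Lambda> \<Longrightarrow> I \<le> mi_nats A UNIV P (cascade \<kappa> (avg_channel W q))"
    and J: "\<And>q. q \<in> pmfs_cost c \<Lambda> \<Longrightarrow> mean UNIV q (\<lambda>s. mi_nats A UNIV P (tap s)) \<le> J"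
  shows "\<exists>\<tau>>0. \<exists>B. \<forall>N>0. \<exists>Mn G \<pi> f \<phi>. real N * (I - J - 6 * \<delta>) \<le> ln (real Mn) \<and>
           secure_code W V c \<Lambda> (B * exp (- (real N * \<tau>))) N Mn G \<pi> f \<phi>"
proof -
  obtain \<theta> where \<theta>: "normalised_score A UNIV P \<theta>"
    and score: "\<And>q. q \<in> pmfs_cost c \<Lambda> \<Longrightarrow> I - \<delta> \<le> mean UNIV q (\<lambda>s. joint_mean A UNIV P (main s) \<theta>)"
    using exists_score[OF ne nonneg(1) \<delta> I] by blast
  obtain \<rho> where \<rho>: "0 < \<rho>" "\<rho> \<le> 1"
    and main_moment: "score_moment_bound \<theta> \<rho> \<delta>"
    and tap_moment: "tap_moment_bound \<rho> \<delta>"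
    using exists_moment_bounds[OF \<delta>] by blast
  have "\<exists>Mn G \<pi> f \<phi>. real N * (I - J - 6 * \<delta>) \<le> ln (real Mn) \<and>
      secure_code W V c \<Lambda> ((3 + 1 / (\<rho> * ln 2)) * exp (- (real N * (\<rho> * \<delta>)))) N Mn G \<pi> f \<phi>"
    if N: "0 < N" for N
  proof -
    define Mn where "Mn = nat \<lceil>exp (real N * (I - J - 6 * \<delta>))\<rceil>"
    define L where "L = nat \<lceil>exp (real N * (J + 2 * \<delta>))\<rceil>"
    have Mn: "0 < Mn" "exp (real N * (I - J - 6 * \<delta>)) \<le> real Mn"
      "real Mn - 1 \<le> exp (real N * (I - J - 6 * \<delta>))"
      unfolding Mn_def by (rule nat_ceiling_bounds; simp)+
    have L: "0 < L" "exp (real N * (J + 2 * \<delta>)) \<le> real L" "real L - 1 \<le> exp (real N * (J + 2 * \<delta>))"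
      unfolding L_def by (rule nat_ceiling_bounds; simp)+
    have "1 \<le> exp (real N * (J + 2 * \<delta>))" using nonneg \<delta> by simp
    then have "real L \<le> 2 * exp (real N * (J + 2 * \<delta>))" using L(3) by linarith
    then have "real (Mn - 1) * real L
        \<le> exp (real N * (I - J - 6 * \<delta>)) * (2 * exp (real N * (J + 2 * \<delta>)))"
      using Mn by (intro mult_mono) (auto simp: of_nat_diff)
    then have size: "real ((Mn - 1) * L) \<le> 2 * exp (real N * (I - 4 * \<delta>))"
      unfolding of_nat_mult by (simp add: exp_add[symmetric] algebra_simps)
    obtain G \<pi> f \<phi> where code: "ensemble_code N Mn L \<theta> (real N * (I - 3 * \<delta>)) G \<pi> f \<phi>"
      using ensemble_code_exists[OF Mn(1) L(1)] by blast
    have "real N * (I - J - 6 * \<delta>) \<le> ln (real Mn)" using Mn by (simp add: ln_ge_iff)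
    then show ?thesis
      using ensemble_code_secure[OF code N \<rho> \<delta> \<theta> main_moment tap_moment score J size L(2)] by blast
  qed
  moreover have "0 < \<rho> * \<delta>" using \<rho> \<delta> by simp
  ultimately show ?thesis by blast
qed

lemma achievable_random_nats:
  assumes ne: "pmfs_cost c \<Lambda> \<noteq> {}" and R: "0 \<le> R" "ln 2 * R \<le> I - J"
    and I: "\<And>q. q \<in> pmfs_cost c \<Lambda> \<Longrightarrow> I \<le> mi_nats A UNIV P (cascade \<kappa> (avg_channel W q))"
    and J: "\<And>q. q \<in> pmfs_cost c \<Lambda> \<Longrightarrow> mean UNIV q (\<lambda>s. mi_nats A UNIV P (tap s)) \<le> J"
  shows "achievable_random W V c \<Lambda> R"
proof (rule achievable_random_if_secure_codes[OF R(1)])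
  fix \<delta> :: real assume \<delta>: "0 < \<delta>"
  obtain q where q: "q \<in> pmfs_cost c \<Lambda>" using ne by blast
  have "0 \<le> mean UNIV q (\<lambda>s. mi_nats A UNIV P (tap s))"
    using q mi_nats_nonneg[OF P kernel_on_tap finite]
    by (intro mean_nonneg) (auto simp: pmfs_cost_def is_pmf_def)
  then have "0 \<le> J" using J[OF q] by linarith
  moreover have "0 \<le> ln 2 * R" using R(1) by simp
  ultimately have "\<exists>\<tau>>0. \<exists>B. \<forall>N>0. \<exists>Mn G \<pi> f \<phi>. real N * (I - J - 6 * (\<delta> / 6)) \<le> ln (real Mn) \<and>
      secure_code W V c \<Lambda> (B * exp (- (real N * \<tau>))) N Mn G \<pi> f \<phi>"
    using R(2) \<delta> by (intro exists_secure_codes[OF ne _ _ _ I J]) auto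
  moreover have "real N * (ln 2 * R - \<delta>) \<le> real N * (I - J - 6 * (\<delta> / 6))" for N
    using R(2) by (intro mult_left_mono) auto
  ultimately show "\<exists>\<tau>>0. \<exists>B. \<forall>N>0. \<exists>Mn G \<pi> f \<phi>. real N * (ln 2 * R - \<delta>) \<le> ln (real Mn) \<and>
      secure_code W V c \<Lambda> (B * exp (- (real N * \<tau>))) N Mn G \<pi> f \<phi>"
    by (meson order_trans)
qed

end

section \<open>The auxiliary variable\<close>

text \<open>Restricting \<open>U\<close> to its support makes the test channel \<open>P\<^sub>X\<^sub>U(x|u)\<close> well defined.\<close>

definition aux_marginal :: "(nat \<Rightarrow> 'x::finite \<Rightarrow> real) \<Rightarrow> nat \<Rightarrow> real" where
  "aux_marginal PUX u = (\<Sum>x\<in>UNIV. PUX u x)"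

definition aux_support :: "nat \<Rightarrow> (nat \<Rightarrow> 'x::finite \<Rightarrow> real) \<Rightarrow> nat set" where
  "aux_support k PUX = {u\<in>{..<k}. 0 < aux_marginal PUX u}"

definition aux_kernel :: "(nat \<Rightarrow> 'x::finite \<Rightarrow> real) \<Rightarrow> nat \<Rightarrow> 'x \<Rightarrow> real" where
  "aux_kernel PUX u x = PUX u x / aux_marginal PUX u"

lemma aux_pmf_eq_0:
  assumes "is_aux_pmf k PUX" "u \<in> {..<k} - aux_support k PUX"
  shows "PUX u x = 0"
proof -
  have nonneg: "0 \<le> PUX u x" for x using assms(1) by (simp add: is_aux_pmf_def)
  then have "0 \<le> aux_marginal PUX u" by (simp add: aux_marginal_def sum_nonneg)
  then have "aux_marginal PUX u = 0" using assms(2) by (simp add: aux_support_def)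
  then show ?thesis using nonneg by (simp add: aux_marginal_def sum_nonneg_eq_0_iff)
qed

lemma prob_on_aux_marginal:
  assumes "is_aux_pmf k PUX"
  shows "prob_on (aux_support k PUX) (aux_marginal PUX)"
proof -
  have "sum (aux_marginal PUX) (aux_support k PUX) = sum (aux_marginal PUX) {..<k}"
    using aux_pmf_eq_0[OF assms]
    by (intro sum.mono_neutral_left) (auto simp: aux_support_def aux_marginal_def)
  then show ?thesis
    using assms
    by (simp add: prob_on_def is_aux_pmf_def aux_marginal_def aux_support_def less_imp_le)
qed

lemma kernel_on_aux_kernel:
  assumes "is_aux_pmf k PUX"
  shows "kernel_on (aux_support k PUX) UNIV (aux_kernel PUX)"
  using assms by (auto simp: kernel_on_def prob_on_def is_aux_pmf_def aux_kernel_def aux_support_def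
      sum_divide_distrib[symmetric] aux_marginal_def[symmetric])

lemma mi_aux_eq_mi_nats:
  fixes T :: "'x::finite \<Rightarrow> 'y::finite \<Rightarrow> real"
  assumes aux: "is_aux_pmf k PUX" and T: "kernel_on UNIV UNIV T"
  shows "mi_aux k PUX T
       = mi_nats (aux_support k PUX) UNIV (aux_marginal PUX) (cascade (aux_kernel PUX) T) / ln 2"
proof -
  have "mi_aux k PUX T = mutual_info (aux_support k PUX) UNIV (\<lambda>u y. \<Sum>x\<in>UNIV. PUX u x * T x y)"
    unfolding mi_aux_def using aux_pmf_eq_0[OF aux]
    by (intro mutual_info_mono_neutral) (auto simp: aux_support_def)
  also have "\<dots>
      = mi_nats (aux_support k PUX) UNIV (aux_marginal PUX) (cascade (aux_kernel PUX) T) / ln 2"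
    using prob_on_aux_marginal[OF aux] kernel_on_cascade[OF kernel_on_aux_kernel[OF aux] T]
    by (rule mutual_info_eq_mi_nats)
      (simp add: aux_support_def aux_kernel_def cascade_def output_prob_def mean_def
        sum_distrib_left)
  finally show ?thesis .
qed

lemma mi_aux_nonneg:
  fixes T :: "'x::finite \<Rightarrow> 'y::finite \<Rightarrow> real"
  assumes "is_aux_pmf k PUX" and "kernel_on UNIV UNIV T"
  shows "0 \<le> mi_aux k PUX T"
  unfolding mi_aux_eq_mi_nats[OF assms] using assms
  by (intro divide_nonneg_nonneg mi_nats_nonneg prob_on_aux_marginal kernel_on_cascade
      kernel_on_aux_kernel) auto

lemma Inf_mi_aux_le_mi_nats:
  fixes W :: "'s::finite \<Rightarrow> 'x::finite \<Rightarrow> 'y::finite \<Rightarrow> real"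
  assumes aux: "is_aux_pmf k PUX" and W: "channel_family W" and q: "q \<in> pmfs_cost c \<Lambda>"
  shows "ln 2 * Inf ((\<lambda>q. mi_aux k PUX (avg_channel W q)) ` pmfs_cost c \<Lambda>)
       \<le> mi_nats (aux_support k PUX) UNIV (aux_marginal PUX)
            (cascade (aux_kernel PUX) (avg_channel W q))"
proof -
  let ?I = "Inf ((\<lambda>q. mi_aux k PUX (avg_channel W q)) ` pmfs_cost c \<Lambda>)"
  have kernel: "kernel_on UNIV UNIV (avg_channel W q)" if "q \<in> pmfs_cost c \<Lambda>" for q
    using W that by (intro kernel_on_avg_channel) (auto simp: pmfs_cost_def)
  have "bdd_below ((\<lambda>q. mi_aux k PUX (avg_channel W q)) ` pmfs_cost c \<Lambda>)"
    by (rule bdd_belowI2) (rule mi_aux_nonneg[OF aux kernel])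
  then have "?I \<le> mi_aux k PUX (avg_channel W q)"
    using q by (intro cInf_lower) auto
  then have "ln 2 * ?I \<le> ln 2 * mi_aux k PUX (avg_channel W q)" by (intro mult_left_mono) auto
  then show ?thesis unfolding mi_aux_eq_mi_nats[OF aux kernel[OF q]] by simp
qed

lemma mean_mi_nats_le_Sup_avg_mi_aux:
  fixes V :: "'s::finite \<Rightarrow> 'x::finite \<Rightarrow> 'z::finite \<Rightarrow> real"
  assumes aux: "is_aux_pmf k PUX" and V: "channel_family V" and q: "q \<in> pmfs_cost c \<Lambda>"
  shows "mean UNIV q (\<lambda>s. mi_nats (aux_support k PUX) UNIV (aux_marginal PUX)
                              (cascade (aux_kernel PUX) (V s)))
       \<le> ln 2 * Sup ((\<lambda>q. avg_mi_aux k PUX V q) ` pmfs_cost c \<Lambda>)" (is "mean UNIV q ?mi \<le> ln 2 * ?J")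
proof -
  have kernel: "kernel_on UNIV UNIV (V s)" for s using V by (simp add: channel_family_iff)
  have "avg_mi_aux k PUX V q \<le> (\<Sum>s\<in>UNIV. mi_aux k PUX (V s))" if "q \<in> pmfs_cost c \<Lambda>" for q
  proof -
    have "prob_on UNIV q" using that by (simp add: pmfs_cost_def is_pmf_iff_prob_on)
    then have "q s * mi_aux k PUX (V s) \<le> 1 * mi_aux k PUX (V s)" for s
      by (intro mult_right_mono prob_on_le_1 mi_aux_nonneg[OF aux kernel]) auto
    then show ?thesis unfolding avg_mi_aux_def by (intro sum_mono) simp
  qed
  then have "bdd_above ((\<lambda>q. avg_mi_aux k PUX V q) ` pmfs_cost c \<Lambda>)"
    by (rule bdd_aboveI2)
  then have "avg_mi_aux k PUX V q \<le> ?J" using q by (intro cSup_upper) auto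
  then have "ln 2 * avg_mi_aux k PUX V q \<le> ln 2 * ?J" by (intro mult_left_mono) auto
  moreover have "avg_mi_aux k PUX V q = mean UNIV q ?mi / ln 2"
    by (simp add: avg_mi_aux_def mean_def mi_aux_eq_mi_nats[OF aux kernel] sum_divide_distrib)
  ultimately show ?thesis by simp
qed

theorem theorem4:
  fixes W :: "'s::finite \<Rightarrow> 'x::finite \<Rightarrow> 'y::finite \<Rightarrow> real"
    and V :: "'s \<Rightarrow> 'x \<Rightarrow> 'z::finite \<Rightarrow> real"
    and c :: "'s \<Rightarrow> real" and \<Lambda> R :: real
  assumes "channel_family W" and "channel_family V"
    and "\<forall>s. 0 \<le> c s" and "\<Lambda> > 0"
    and "R \<ge> 0"
    and "\<exists>k PUX. is_aux_pmf k PUX \<and>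
           R \<le> Inf ((\<lambda>q. mi_aux k PUX (avg_channel W q)) ` pmfs_cost c \<Lambda>)
              - Sup ((\<lambda>q'. avg_mi_aux k PUX V q') ` pmfs_cost c \<Lambda>)"
  shows "achievable_random W V c \<Lambda> R"
proof (cases "pmfs_cost c \<Lambda> = {}")
  case True
  then show ?thesis using assms(5) by (rule achievable_random_if_pmfs_cost_empty)
next
  case False
  obtain k PUX where aux: "is_aux_pmf k PUX"
    and R: "R \<le> Inf ((\<lambda>q. mi_aux k PUX (avg_channel W q)) ` pmfs_cost c \<Lambda>)
              - Sup ((\<lambda>q'. avg_mi_aux k PUX V q') ` pmfs_cost c \<Lambda>)" (is "R \<le> ?I - ?J")
    using assms(6) by blast
  interpret wiretap_input W V "aux_support k PUX" "aux_marginal PUX" "aux_kernel PUX"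
    using assms(1,2) prob_on_aux_marginal[OF aux] kernel_on_aux_kernel[OF aux]
    by unfold_locales (simp_all add: aux_support_def)
  have "ln 2 * R \<le> ln 2 * ?I - ln 2 * ?J" using R by (simp add: right_diff_distrib[symmetric])
  then show ?thesis
    using Inf_mi_aux_le_mi_nats[OF aux assms(1)] mean_mi_nats_le_Sup_avg_mi_aux[OF aux assms(2)]
    by (rule achievable_random_nats[OF False assms(5)])
qed

end
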